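(* Let $(\mathcal D_n)_{n\in\mathbb N}$, $\mathcal D_n=(\phi_\omega^n:\omega\in\Omega_n)$, be an asymptotically stable family of frames of $\mathbb R^{I_n}$, and let $(\epsilon_n)_{n\in\mathbb N}$ be a sequence of random vectors in $\mathbb R^{I_n}$ with independent $N(0,\sigma^2)$-distributed entries. Then, for every $z\in\mathbb R$, $$\lim_{n\to\infty}\mathbf P\left\{\max_{\omega\in\Omega_n}|\langle\phi_\omega^n,\epsilon_n\rangle|\le \sigma\sqrt{2\log|\Omega_n|}+\sigma\,\frac{2z-\log\log|\Omega_n|-\log\pi}{2\sqrt{2\log|\Omega_n|}}\right\}=\exp(-e^{-z}).$$
   Context: Fix $d\in\mathbb N$ and $\sigma>0$; $I_n=\{0,\dots,n-1\}^d$, and $\mathbb R^{I_n}$ carries the Euclidean inner product $\langle\cdot,\cdot\rangle$ and norm $\|\cdot\|$. For each $n$, $\mathcal D_n=(\phi_\omega^n:\omega\in\Omega_n)$, with $\Omega_n$ a finite index set, is a frame of $\mathbb R^{I_n}$: there are constants $0<a_n\le b_n<\infty$ with $a_n\|u\|^2\le\sum_{\omega\in\Omega_n}|\langle\phi_\omega^n,u\rangle|^2\le b_n\|u\|^2$ for all $u\in\mathbb R^{I_n}$; the frame bounds $a_n,b_n$ are the largest, respectively smallest, such constants. A family of frames $(\mathcal D_n)_n$ with normalized elements ($\|\phi_\omega^n\|=1$ for all $\omega\in\Omega_n$) is called asymptotically stable if (i) for some $\rho\in(0,1)$, $|\{(\omega,\omega')\in\Omega_n^2:\omega\ne\omega',\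 |\langle\phi_\omega^n,\phi_{\omega'}^n\rangle|\ge\rho\}|=o\big(|\Omega_n|/\sqrt{\log|\Omega_n|}\big)$ as $n\to\infty$; and (ii) $\sup_n b_n<\infty$. *)

theory Defs
  imports "HOL-Probability.Probability" "HOL-Library.Landau_Symbols"
begin

text \<open>
  A vector of \<open>\<real>\<^sup>I\<close>, for a finite index set \<open>I\<close>, is represented by a function \<open>'i \<Rightarrow> real\<close>
  of which only the values on \<open>I\<close> matter; its Euclidean norm is \<open>L2_set u I\<close>.
\<close>

definition grid :: "nat \<Rightarrow> nat \<Rightarrow> (nat \<Rightarrow> nat) set" where
  "grid d n = {..<d} \<rightarrow>\<^sub>E {..<n}"

definition inner_on :: "'i set \<Rightarrow> ('i \<Rightarrow> real) \<Rightarrow> ('i \<Rightarrow> real) \<Rightarrow> real" where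
  "inner_on I u v = (\<Sum>i\<in>I. u i * v i)"

definition frame_constants ::
  "'i set \<Rightarrow> 'w set \<Rightarrow> ('w \<Rightarrow> 'i \<Rightarrow> real) \<Rightarrow> real \<Rightarrow> real \<Rightarrow> bool" where
  "frame_constants I W \<phi> a b \<longleftrightarrow> 0 < a \<and> a \<le> b \<and>
     (\<forall>u. a * (L2_set u I)\<^sup>2 \<le> (\<Sum>\<omega>\<in>W. \<bar>inner_on I (\<phi> \<omega>) u\<bar>\<^sup>2) \<and>
          (\<Sum>\<omega>\<in>W. \<bar>inner_on I (\<phi> \<omega>) u\<bar>\<^sup>2) \<le> b * (L2_set u I)\<^sup>2)"

definition is_frame :: "'i set \<Rightarrow> 'w set \<Rightarrow> ('w \<Rightarrow> 'i \<Rightarrow> real) \<Rightarrow> bool" where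
  "is_frame I W \<phi> \<longleftrightarrow> finite W \<and> (\<exists>a b. frame_constants I W \<phi> a b)"

text \<open>The smallest constant exists for every frame of \<open>\<real>\<^sup>I\<close> with \<open>I\<close> finite and nonempty.\<close>

definition upper_frame_bound :: "'i set \<Rightarrow> 'w set \<Rightarrow> ('w \<Rightarrow> 'i \<Rightarrow> real) \<Rightarrow> real" where
  "upper_frame_bound I W \<phi> = (LEAST b. \<exists>a. frame_constants I W \<phi> a b)"

text \<open>
  Families are indexed by the positive integers: \<open>grid d 0\<close> is empty for \<open>d \<ge> 1\<close>, and the
  zero space has no frame bounds in the sense above.
\<close>

definition asymptotically_stable ::
  "(nat \<Rightarrow> 'i set) \<Rightarrow> (nat \<Rightarrow> 'w set) \<Rightarrow> (nat \<Rightarrow> 'w \<Rightarrow> 'i \<Rightarrow> real) \<Rightarrow> bool" where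
  "asymptotically_stable I \<Omega> \<phi> \<longleftrightarrow>
     (\<forall>n\<ge>1. is_frame (I n) (\<Omega> n) (\<phi> n)) \<and>
     (\<forall>n\<ge>1. \<forall>\<omega>\<in>\<Omega> n. L2_set (\<phi> n \<omega>) (I n) = 1) \<and>
     (\<exists>\<rho>. 0 < \<rho> \<and> \<rho> < 1 \<and>
        (\<lambda>n. real (card {(\<omega>, \<omega>'). \<omega> \<in> \<Omega> n \<and> \<omega>' \<in> \<Omega> n \<and> \<omega> \<noteq> \<omega>' \<and>
                                \<bar>inner_on (I n) (\<phi> n \<omega>) (\<phi> n \<omega>')\<bar> \<ge> \<rho>}))
          \<in> o(\<lambda>n. real (card (\<Omega> n)) / sqrt (ln (real (card (\<Omega> n)))))) \<and>
     bdd_above ((\<lambda>n. upper_frame_bound (I n) (\<Omega> n) (\<phi> n)) ` {1..})"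

end

theory Submission
  imports Defs "HOL-Real_Asymp.Real_Asymp"
begin

text \<open>
  Normalise to \<open>\<sigma> = 1\<close> and write \<open>X\<^sub>\<omega>\<close> for the frame coefficients. Removing every \<open>\<omega>\<close> that
  is strongly correlated with some other index changes the probability by \<open>o(1)\<close>: only
  \<open>o(N / sqrt (ln N))\<close> indices are involved, and each exceeds the level with probability
  \<open>O(sqrt (ln N) / N)\<close>. On the remaining index set the probability is sandwiched between
  expectations of products \<open>\<Prod>\<^sub>\<omega> g (X\<^sub>\<omega>)\<close>, where \<open>g\<close> is a smooth cutoff whose transition window has
  width \<open>\<delta> / sqrt (2 ln N)\<close>, which amounts to a shift of \<open>z\<close> by \<open>\<delta>\<close>. Along the path
  \<open>cos t Y + sin t X\<close> from an independent standard normal family \<open>Y\<close> to \<open>X\<close>, Gaussian integration by parts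
  expresses the derivative of such an expectation as a sum over pairs of distinct indices; each
  term is at most a power of \<open>ln N\<close> times \<open>\<bar>\<kappa>\<bar> exp (- u\<^sup>2 / (1 + \<bar>\<kappa>\<bar>))\<close>, with \<open>\<kappa>\<close> the correlation. Since
  the squared correlations of each index sum to at most the upper frame bound, the total is
  \<open>o(1)\<close>, and the independent case is the classical Gumbel limit.
\<close>

text \<open>The frame bound controls sums of squared correlations, while the comparison inequality
  involves their first powers. For \<open>k \<ge> 1 / 8\<close> one has
  \<open>k \<le> 8 * k\<^sup>2\<close>, and \<open>k \<le> \<rho> < 1\<close> makes the exponential
  of order N^(-2/(1+\<rho>)) up to logarithms, which beats the N rows. Smaller correlations may be
  numerous: passing to squares by the AM-GM inequality costs N^(3/2) in total, but their exponential
  is about N^(-16/9). A correlation near 1 leaves only about 1/N per pair, with no gain over the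
  number of rows; such indices must therefore go beforehand.

  The cutoff must be twice differentiable, since differentiating along the path and then integrating
  by parts differentiates a factor twice. Its second derivative appears only on the diagonal, where
  the coefficient vanishes, so the steepness of the window enters through the squared slope alone.
  That is of order ln N, which the spare powers of N absorb.\<close>

subsection \<open>Gaussian integration by parts\<close>

lemma std_normal_density_has_derivative:
  "(std_normal_density has_real_derivative - x * std_normal_density x) (at x)"
  unfolding std_normal_density_def[abs_def]
  by (auto intro!: derivative_eq_intros simp: field_simps)

lemma integrable_std_normal_distribution_bounded:
  fixes f :: "real \<Rightarrow> real"
  assumes "f \<in> borel_measurable borel" "\<And>x. \<bar>f x\<bar> \<le> C"
  shows "integrable std_normal_distribution f"
proof -
  interpret real_distribution std_normal_distribution by (rule real_dist_normal_dist)
  show ?thesis using assms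
    by (intro integrable_const_bound[of _ C]) auto
qed

text \<open>With p the normal density, x p f - p f' is the derivative of -p f, and -p f tends to 0
  at both ends of the line because \<open>f\<close> is bounded. The fundamental theorem of calculus
  on the whole line then gives the identity.\<close>

lemma stein_identity:
  fixes f f' :: "real \<Rightarrow> real"
  assumes der: "\<And>x. (f has_real_derivative f' x) (at x)"
    and cont: "\<And>x. isCont f' x"
    and bd: "\<And>x. \<bar>f x\<bar> \<le> C" "\<And>x. \<bar>f' x\<bar> \<le> C"
  shows "(LINT x|std_normal_distribution. x * f x) = (LINT x|std_normal_distribution. f' x)"
    and "integrable std_normal_distribution (\<lambda>x. x * f x)"
proof -
  interpret real_distribution std_normal_distribution by (rule real_dist_normal_dist)
  have contf: "isCont f x" for x using der[of x] by (rule DERIV_isCont)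
  have m[measurable]: "f \<in> borel_measurable borel" "f' \<in> borel_measurable borel"
    using contf cont by (auto intro!: borel_measurable_continuous_onI continuous_at_imp_continuous_on)
  have i1: "integrable std_normal_distribution f'"
    by (rule integrable_std_normal_distribution_bounded[OF m(2) bd(2)])
  show i2: "integrable std_normal_distribution (\<lambda>x. x * f x)"
  proof (rule Bochner_Integration.integrable_bound)
    show "integrable std_normal_distribution (\<lambda>x. C * x)"
      using integrable_std_normal_distribution_moment[of 1] by simp
    have "\<bar>f x\<bar> \<le> \<bar>C\<bar>" for x using bd(1)[of x] by simp
    then show "AE x in std_normal_distribution. norm (x * f x) \<le> norm (C * x)"
      by (auto simp: abs_mult mult.commute intro!: AE_I2 mult_left_mono)
  qed simp
  let ?p = std_normal_density
  let ?h = "\<lambda>x. ?p x * (x * f x) - ?p x * f' x"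
  have ih: "integrable lborel (\<lambda>x. ?p x * (x * f x))" "integrable lborel (\<lambda>x. ?p x * f' x)"
    using i1 i2 by (simp_all add: integrable_density)
  have p0: "(?p \<longlongrightarrow> 0) at_top" "(?p \<longlongrightarrow> 0) at_bot"
    unfolding std_normal_density_def[abs_def] by real_asymp+
  have lim: "((\<lambda>x. - (?p x * f x)) \<longlongrightarrow> 0) F" if "(?p \<longlongrightarrow> 0) F" for F
  proof -
    have "((\<lambda>x. ?p x * f x) \<longlongrightarrow> 0) F"
    proof (rule Lim_null_comparison)
      show "\<forall>\<^sub>F x in F. norm (?p x * f x) \<le> ?p x * C"
        using bd(1) by (intro always_eventually allI) (auto simp: abs_mult intro!: mult_left_mono)
      show "((\<lambda>x. ?p x * C) \<longlongrightarrow> 0) F" using tendsto_mult_right[OF that, of C] by simp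
    qed
    from tendsto_minus[OF this] show ?thesis by simp
  qed
  have "(LBINT x=-\<infinity>..\<infinity>. ?h x) = 0 - 0"
  proof (rule interval_integral_FTC_integrable)
    show "((\<lambda>x. - (?p x * f x)) has_vector_derivative ?h x) (at x)" for x
      unfolding has_real_derivative_iff_has_vector_derivative[symmetric]
      by (auto intro!: derivative_eq_intros std_normal_density_has_derivative der simp: field_simps)
    show "isCont ?h x" for x
      by (auto intro!: continuous_intros contf cont DERIV_isCont[OF std_normal_density_has_derivative])
    show "set_integrable lborel (einterval (-\<infinity>) \<infinity>) ?h"
      using ih by (simp add: set_integrable_def)
    show "(((\<lambda>x. - (?p x * f x)) \<circ> real_of_ereal) \<longlongrightarrow> 0) (at_right (-\<infinity>))"
      "(((\<lambda>x. - (?p x * f x)) \<circ> real_of_ereal) \<longlongrightarrow> 0) (at_left \<infinity>)"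
      using lim p0 by (auto simp: ereal_tendsto_simps)
  qed simp
  then have "(LBINT x. ?h x) = 0"
    by (simp add: interval_lebesgue_integral_def set_lebesgue_integral_def)
  then have "(LBINT x. ?p x * (x * f x)) = (LBINT x. ?p x * f' x)"
    using ih by simp
  then show "(LINT x|std_normal_distribution. x * f x) = (LINT x|std_normal_distribution. f' x)"
    by (simp add: integral_density)
qed

section \<open>Exponential moments and tails of Gaussian linear forms\<close>

text \<open>Completing the square: tilting the standard density by \<open>exp (a * x)\<close> gives
  \<open>exp (a\<^sup>2 / 2)\<close> times the density of N(a, 1).\<close>

lemma std_normal_mgf:
  "has_bochner_integral std_normal_distribution (\<lambda>x. exp (a * x)) (exp (a\<^sup>2 / 2))"
proof -
  have eq: "std_normal_density x * exp (a * x) = exp (a\<^sup>2 / 2) * normal_density a 1 x" for x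
    unfolding normal_density_def by (simp add: field_simps power2_eq_square flip: exp_add)
  have "has_bochner_integral lborel (\<lambda>x. exp (a\<^sup>2 / 2) * normal_density a 1 x) (exp (a\<^sup>2 / 2) * 1)"
    by (intro has_bochner_integral_mult_right) (simp add: has_bochner_integral_iff)
  then show ?thesis
    by (subst has_bochner_integral_density) (auto simp: eq)
qed

abbreviation gauss :: "'j set \<Rightarrow> ('j \<Rightarrow> real) measure" where
  "gauss J \<equiv> \<Pi>\<^sub>M j\<in>J. std_normal_distribution"

lemma product_prob_space_gauss: "product_prob_space (\<lambda>_. std_normal_distribution)"
  by (intro product_prob_spaceI prob_space_normal_density) simp

lemma prob_space_gauss: "prob_space (gauss J)"
  by (intro prob_space_PiM prob_space_normal_density) simp

lemma borel_measurable_inner_on_gauss [measurable]: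
  "inner_on J a \<in> borel_measurable (gauss J)"
  unfolding inner_on_def[abs_def] by measurable

lemma integrable_gauss_bounded:
  fixes f :: "_ \<Rightarrow> real"
  assumes "f \<in> borel_measurable (gauss J)" "\<And>x. \<bar>f x\<bar> \<le> C"
  shows "integrable (gauss J) f"
proof -
  interpret prob_space "gauss J" by (rule prob_space_gauss)
  show ?thesis using assms by (intro integrable_const_bound[of _ C]) auto
qed

lemma gauss_mgf:
  assumes "finite J"
  shows "integrable (gauss J) (\<lambda>x. exp (inner_on J a x))"
    and "(LINT x|gauss J. exp (inner_on J a x)) = exp ((\<Sum>j\<in>J. (a j)\<^sup>2) / 2)"
proof -
  interpret product_prob_space "\<lambda>_. std_normal_distribution" J by (rule product_prob_space_gauss)
  have eq: "exp (inner_on J a x) = (\<Prod>j\<in>J. exp (a j * x j))" for x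
    using assms by (simp add: inner_on_def exp_sum)
  have i: "integrable std_normal_distribution (\<lambda>x. exp (a j * x))" for j
    using std_normal_mgf by (auto simp: has_bochner_integral_iff)
  show "integrable (gauss J) (\<lambda>x. exp (inner_on J a x))"
    unfolding eq by (rule product_integrable_prod[OF assms i])
  show "(LINT x|gauss J. exp (inner_on J a x)) = exp ((\<Sum>j\<in>J. (a j)\<^sup>2) / 2)"
    unfolding eq product_integral_prod[OF assms i] using assms
    by (simp add: has_bochner_integral_integral_eq[OF std_normal_mgf] exp_sum sum_divide_distrib)
qed

text \<open>Chernoff's bound. Letting \<open>s\<close> exceed the true variance allows one exponent
  to serve all four sign choices in \<open>gauss_pair_tail\<close>.\<close>

lemma gauss_tail:
  assumes J: "finite J" and s: "(\<Sum>j\<in>J. (a j)\<^sup>2) \<le> s" "s > 0" and t: "t \<ge> 0"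
  shows "measure (gauss J) {x \<in> space (gauss J). inner_on J a x \<ge> t} \<le> exp (- t\<^sup>2 / (2 * s))"
proof -
  interpret prob_space "gauss J" by (rule prob_space_gauss)
  \<comment> \<open>This value minimizes the Chernoff exponent
    \<open>l\<^sup>2 * s / 2 - l * t\<close>.\<close>
  define l where "l = t / s"
  have l: "l \<ge> 0" using s t by (simp add: l_def)
  let ?a = "\<lambda>j. l * a j"
  have eq: "inner_on J ?a x = l * inner_on J a x" for x
    by (simp add: inner_on_def sum_distrib_left mult.assoc)
  have "measure (gauss J) {x \<in> space (gauss J). inner_on J a x \<ge> t}
      \<le> measure (gauss J) {x \<in> space (gauss J). exp (inner_on J ?a x) \<ge> exp (l * t)}"
    using l by (intro finite_measure_mono) (auto simp: eq intro: mult_left_mono)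
  also have "\<dots> \<le> (LINT x|gauss J. exp (inner_on J ?a x)) / exp (l * t)"
    by (rule integral_Markov_inequality_measure[OF gauss_mgf(1)[OF J], where A = "{}"]) auto
  also have "\<dots> = exp (l\<^sup>2 * (\<Sum>j\<in>J. (a j)\<^sup>2) / 2 - l * t)"
    by (simp add: gauss_mgf(2)[OF J] exp_diff power_mult_distrib sum_distrib_left)
  also have "\<dots> \<le> exp (l\<^sup>2 * s / 2 - l * t)"
    using s by (auto intro!: mult_left_mono)
  also have "l\<^sup>2 * s / 2 - l * t = - t\<^sup>2 / (2 * s)"
    using s by (simp add: l_def power2_eq_square field_simps)
  finally show ?thesis .
qed

section \<open>Integration by parts in several variables\<close>

lemma integrable_gauss_component_times:
  fixes G :: "_ \<Rightarrow> real"
  assumes j: "j \<in> J" and [measurable]: "G \<in> borel_measurable (gauss J)" and bd: "\<And>x. \<bar>G x\<bar> \<le> C"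
  shows "integrable (gauss J) (\<lambda>x. x j * G x)"
proof -
  interpret product_prob_space "\<lambda>_. std_normal_distribution" J by (rule product_prob_space_gauss)
  have "integrable (distr (gauss J) std_normal_distribution (\<lambda>x. x j)) (\<lambda>x. C * x)"
    unfolding PiM_component[OF j] using integrable_std_normal_distribution_moment[of 1] by simp
  then have i: "integrable (gauss J) (\<lambda>x. C * x j)"
    by (rule integrable_distr[OF measurable_component_singleton[OF j]])
  have m: "(\<lambda>x. x j) \<in> borel_measurable (gauss J)"
    using measurable_component_singleton[OF j, of "\<lambda>_. std_normal_distribution"]
    by (simp cong: measurable_cong_sets)
  show ?thesis
  proof (rule Bochner_Integration.integrable_bound[OF i])
    show "(\<lambda>x. x j * G x) \<in> borel_measurable (gauss J)" using m by measurable
    have "\<bar>G x\<bar> \<le> \<bar>C\<bar>" for x using bd[of x] by simp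
    then show "AE x in gauss J. norm (x j * G x) \<le> norm (C * x j)"
      by (auto simp: abs_mult mult.commute[of "\<bar>C\<bar>"] intro!: AE_I2 mult_left_mono)
  qed
qed

text \<open>Fubini isolates coordinate \<open>j\<close>, and the one-dimensional identity applies on
  every fibre. This is why \<open>G'\<close> is required to be continuous along the fibre
  only.\<close>

lemma stein_gauss:
  fixes G G' :: "('j \<Rightarrow> real) \<Rightarrow> real"
  assumes J: "finite J" "j \<in> J"
    and m: "G \<in> borel_measurable (gauss J)" "G' \<in> borel_measurable (gauss J)"
    and der: "\<And>x. ((\<lambda>s. G (x(j := s))) has_real_derivative G' x) (at (x j))"
    and cont: "\<And>x s. isCont (\<lambda>s. G' (x(j := s))) s"
    and bd: "\<And>x. \<bar>G x\<bar> \<le> C" "\<And>x. \<bar>G' x\<bar> \<le> C"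
  shows "(LINT x|gauss J. x j * G x) = (LINT x|gauss J. G' x)"
proof -
  interpret product_prob_space "\<lambda>_. std_normal_distribution" J by (rule product_prob_space_gauss)
  define K where "K = J - {j}"
  have K: "J = insert j K" "finite K" "j \<notin> K" using J by (auto simp: K_def)
  have i: "integrable (gauss J) (\<lambda>x. x j * G x)" "integrable (gauss J) G'"
    using integrable_gauss_component_times[OF J(2) m(1) bd(1)] integrable_gauss_bounded[OF m(2) bd(2)]
    by auto
  have st: "(LINT s|std_normal_distribution. s * G (x(j := s))) =
      (LINT s|std_normal_distribution. G' (x(j := s)))" for x
  proof (rule stein_identity(1))
    show "((\<lambda>s. G (x(j := s))) has_real_derivative G' (x(j := y))) (at y)" for y
      using der[of "x(j := y)"] by simp
  qed (use cont bd in auto)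
  have "(LINT x|gauss J. x j * G x) =
      (LINT x|gauss K. LINT s|std_normal_distribution. s * G (x(j := s)))"
    using product_integral_insert[OF K(2,3) i(1)[unfolded K(1)]] by (simp only: K(1)[symmetric] fun_upd_same)
  also have "\<dots> = (LINT x|gauss K. LINT s|std_normal_distribution. G' (x(j := s)))"
    by (simp only: st)
  also have "\<dots> = (LINT x|gauss J. G' x)"
    using product_integral_insert[OF K(2,3) i(2)[unfolded K(1)]] by (simp only: K(1)[symmetric])
  finally show ?thesis .
qed

lemma inner_on_upd:
  assumes "finite J" "j \<in> J"
  shows "inner_on J a (x(j := s)) = inner_on J a x + a j * (s - x j)"
proof -
  have "inner_on J a (x(j := s)) = a j * s + (\<Sum>i\<in>J - {j}. a i * x i)"
    unfolding inner_on_def using assms by (subst sum.remove[of _ j]) auto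
  moreover have "inner_on J a x = a j * x j + (\<Sum>i\<in>J - {j}. a i * x i)"
    unfolding inner_on_def using assms by (rule sum.remove)
  ultimately show ?thesis by (simp add: algebra_simps)
qed

lemma abs_prod_le_power:
  fixes f :: "'w \<Rightarrow> real"
  assumes "finite W" "S \<subseteq> W" "1 \<le> D" "\<And>v. v \<in> W \<Longrightarrow> \<bar>f v\<bar> \<le> D"
  shows "\<bar>\<Prod>v\<in>S. f v\<bar> \<le> D ^ card W"
proof -
  have "\<bar>\<Prod>v\<in>S. f v\<bar> = (\<Prod>v\<in>S. \<bar>f v\<bar>)" by (rule abs_prod)
  also have "\<dots> \<le> (\<Prod>v\<in>S. D)" using assms by (intro prod_mono) auto
  also have "\<dots> \<le> D ^ card W" using assms by (auto intro!: power_increasing card_mono)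
  finally show ?thesis .
qed

text \<open>For each coordinate \<open>j\<close> the product and chain rules give terms weighted by
  \<open>A v j\<close>; summing against \<open>c j\<close> turns the weights into
  \<open>inner_on J c (A v)\<close>. The factors may differ from index to index because the
  comparison argument uses \<open>g'\<close> in one slot and \<open>g\<close> in all others.\<close>

lemma gauss_integration_by_parts:
  fixes h h' :: "'w \<Rightarrow> real \<Rightarrow> real"
  assumes J: "finite J" and W: "finite W"
    and der: "\<And>v x. v \<in> W \<Longrightarrow> (h v has_real_derivative h' v x) (at x)"
    and cont: "\<And>v x. v \<in> W \<Longrightarrow> isCont (h' v) x"
    and bd: "\<And>v x. v \<in> W \<Longrightarrow> \<bar>h v x\<bar> \<le> C" "\<And>v x. v \<in> W \<Longrightarrow> \<bar>h' v x\<bar> \<le> C"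
  shows "(LINT x|gauss J. inner_on J c x * (\<Prod>v\<in>W. h v (inner_on J (A v) x))) =
    (\<Sum>v\<in>W. inner_on J c (A v) *
       (LINT x|gauss J. h' v (inner_on J (A v) x) * (\<Prod>w\<in>W - {v}. h w (inner_on J (A w) x))))"
proof -
  \<comment> \<open>Since \<open>D\<close> is at least 1, \<open>D ^ card W\<close> also bounds
    products over the smaller sets \<open>W - {v}\<close>.\<close>
  define D where "D = max 1 C"
  have D: "1 \<le> D" "\<And>v x. v \<in> W \<Longrightarrow> \<bar>h v x\<bar> \<le> D" "\<And>v x. v \<in> W \<Longrightarrow> \<bar>h' v x\<bar> \<le> D"
    using bd by (auto simp: D_def intro: order.trans[OF _ max.cobounded2])
  have hcont: "isCont (h v) x" if "v \<in> W" for v x using der[OF that] by (rule DERIV_isCont)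
  have hm[measurable]: "h v \<in> borel_measurable borel" "h' v \<in> borel_measurable borel" if "v \<in> W" for v
    using hcont[OF that] cont[OF that]
    by (auto intro!: borel_measurable_continuous_onI continuous_at_imp_continuous_on)
  define G where "G = (\<lambda>x. \<Prod>v\<in>W. h v (inner_on J (A v) x))"
  define T where "T = (\<lambda>v x. h' v (inner_on J (A v) x) * (\<Prod>w\<in>W - {v}. h w (inner_on J (A w) x)))"
  have Gm: "G \<in> borel_measurable (gauss J)" unfolding G_def by measurable
  have Tm: "T v \<in> borel_measurable (gauss J)" if "v \<in> W" for v
    unfolding T_def using that by measurable
  have Gb: "\<bar>G x\<bar> \<le> D ^ card W" for x
    unfolding G_def using D W by (intro abs_prod_le_power) auto
  have Tb: "\<bar>T v x\<bar> \<le> D * D ^ card W" if "v \<in> W" for v x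
    unfolding T_def abs_mult using D W that
    by (intro mult_mono abs_prod_le_power) auto
  have Ti: "integrable (gauss J) (T v)" if "v \<in> W" for v
    by (rule integrable_gauss_bounded[OF Tm[OF that] Tb[OF that]])
  have j: "(LINT x|gauss J. x j * G x) = (\<Sum>v\<in>W. A v j * (LINT x|gauss J. T v x))"
    if j: "j \<in> J" for j
  proof -
    have "(LINT x|gauss J. x j * G x) = (LINT x|gauss J. (\<Sum>v\<in>W. A v j * T v x))"
    proof (rule stein_gauss[OF J j Gm])
      show "(\<lambda>x. \<Sum>v\<in>W. A v j * T v x) \<in> borel_measurable (gauss J)"
        using Tm by measurable
      show "((\<lambda>s. G (x(j := s))) has_real_derivative (\<Sum>v\<in>W. A v j * T v x)) (at (x j))" for x
      proof -
        have "((\<lambda>s. h v (inner_on J (A v) x + A v j * (s - x j))) has_real_derivative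
            h' v (inner_on J (A v) x) * A v j) (at (x j))" if "v \<in> W" for v
          by (rule DERIV_chain2[of "h v"])
            (use der[OF that, of "inner_on J (A v) x"] in \<open>auto intro!: derivative_eq_intros\<close>)
        from has_field_derivative_prod[OF this] show ?thesis
          unfolding G_def T_def inner_on_upd[OF J j] by (simp add: mult_ac)
      qed
      show "isCont (\<lambda>s. \<Sum>v\<in>W. A v j * T v (x(j := s))) s" for x s
        unfolding T_def inner_on_upd[OF J j]
        by (intro continuous_intros isCont_o2[OF _ cont] isCont_o2[OF _ hcont]) auto
      show "\<bar>G x\<bar> \<le> (1 + (\<Sum>v\<in>W. \<bar>A v j\<bar>)) * (D * D ^ card W)" for x
      proof -
        have "D ^ card W \<le> D * D ^ card W" using D by (simp add: mult_le_cancel_right1)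
        also have "\<dots> \<le> (1 + (\<Sum>v\<in>W. \<bar>A v j\<bar>)) * (D * D ^ card W)"
          using D(1) by (simp add: distrib_right sum_nonneg)
        finally show ?thesis using Gb[of x] by linarith
      qed
      show "\<bar>\<Sum>v\<in>W. A v j * T v x\<bar> \<le> (1 + (\<Sum>v\<in>W. \<bar>A v j\<bar>)) * (D * D ^ card W)" for x
      proof -
        have "\<bar>\<Sum>v\<in>W. A v j * T v x\<bar> \<le> (\<Sum>v\<in>W. \<bar>A v j * T v x\<bar>)" by (rule sum_abs)
        also have "\<dots> \<le> (\<Sum>v\<in>W. \<bar>A v j\<bar> * (D * D ^ card W))"
          using Tb by (intro sum_mono) (auto simp: abs_mult intro!: mult_left_mono)
        also have "\<dots> \<le> (1 + (\<Sum>v\<in>W. \<bar>A v j\<bar>)) * (D * D ^ card W)"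
          using D by (simp add: sum_distrib_right distrib_right)
        finally show ?thesis .
      qed
    qed
    also have "\<dots> = (\<Sum>v\<in>W. A v j * (LINT x|gauss J. T v x))"
      using Ti by (subst Bochner_Integration.integral_sum) auto
    finally show ?thesis .
  qed
  have "(LINT x|gauss J. inner_on J c x * G x) = (LINT x|gauss J. (\<Sum>j\<in>J. c j * (x j * G x)))"
    by (simp add: inner_on_def sum_distrib_right mult.assoc)
  also have "\<dots> = (\<Sum>j\<in>J. c j * (LINT x|gauss J. x j * G x))"
    using integrable_gauss_component_times[OF _ Gm Gb]
    by (subst Bochner_Integration.integral_sum) auto
  also have "\<dots> = (\<Sum>j\<in>J. \<Sum>v\<in>W. c j * A v j * (LINT x|gauss J. T v x))"
    by (simp add: j sum_distrib_left mult.assoc)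
  also have "\<dots> = (\<Sum>v\<in>W. \<Sum>j\<in>J. c j * A v j * (LINT x|gauss J. T v x))"
    by (rule sum.swap)
  also have "\<dots> = (\<Sum>v\<in>W. inner_on J c (A v) * (LINT x|gauss J. T v x))"
    by (simp add: inner_on_def sum_distrib_right)
  finally show ?thesis by (simp add: G_def T_def)
qed

subsection \<open>Differentiation under the integral and smooth cutoffs\<close>

text \<open>By the mean value inequality the bound \<open>w\<close> on the derivative also dominates
  every difference quotient, so dominated convergence applies along each sequence of increments
  tending to 0.\<close>

lemma has_real_derivative_integral:
  fixes f f' :: "real \<Rightarrow> 'a \<Rightarrow> real"
  assumes der: "\<And>t x. x \<in> space M \<Longrightarrow> ((\<lambda>t. f t x) has_real_derivative f' t x) (at t)"
    and int: "\<And>t. integrable M (f t)" and m: "\<And>t. f' t \<in> borel_measurable M"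
    and dom: "\<And>t x. x \<in> space M \<Longrightarrow> \<bar>f' t x\<bar> \<le> w x" "integrable M w"
  shows "((\<lambda>t. LINT x|M. f t x) has_real_derivative (LINT x|M. f' t x)) (at t)"
  unfolding DERIV_def tendsto_at_iff_sequentially
proof (intro allI impI)
  fix X :: "nat \<Rightarrow> real"
  assume "\<forall>i. X i \<in> UNIV - {0}" and X: "X \<longlonglongrightarrow> 0"
  then have X0: "X i \<noteq> 0" for i by auto
  let ?q = "\<lambda>i x. (f (t + X i) x - f t x) / X i"
  have "(\<lambda>i. LINT x|M. ?q i x) \<longlonglongrightarrow> (LINT x|M. f' t x)"
  proof (rule integral_dominated_convergence[OF m _ dom(2)])
    show "?q i \<in> borel_measurable M" for i
      using int[of t] int[of "t + X i"] by measurable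
    show "AE x in M. (\<lambda>i. ?q i x) \<longlonglongrightarrow> f' t x"
    proof (rule AE_I2)
      fix x assume "x \<in> space M"
      from der[OF this, of t] X X0 show "(\<lambda>i. ?q i x) \<longlonglongrightarrow> f' t x"
        unfolding DERIV_def tendsto_at_iff_sequentially by (auto simp: o_def)
    qed
    show "AE x in M. norm (?q i x) \<le> w x" for i
    proof (rule AE_I2)
      fix x assume x: "x \<in> space M"
      have "norm (f (t + X i) x - f t x) \<le> w x * norm (t + X i - t)"
        by (rule field_differentiable_bound[of UNIV "\<lambda>t. f t x" "\<lambda>t. f' t x"])
          (use der[OF x] dom(1)[OF x] in auto)
      then show "norm (?q i x) \<le> w x"
        using X0[of i] by (simp add: field_simps)
    qed
  qed
  then show "((\<lambda>h. ((LINT x|M. f (t + h) x) - (LINT x|M. f t x)) / h) \<circ> X) \<longlonglongrightarrow> (LINT x|M. f' t x)"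
    using int by (simp add: o_def)
qed

section \<open>A twice differentiable cutoff from truncated powers\<close>

lemma has_real_derivative_max_0_power:
  "((\<lambda>t::real. max 0 t ^ Suc (Suc n)) has_real_derivative (real (n + 2) * max 0 t ^ Suc n)) (at t)"
proof -
  consider "t > 0" | "t < 0" | "t = 0" by linarith
  then show ?thesis
  proof cases
    case 1
    have "((\<lambda>t::real. t ^ Suc (Suc n)) has_real_derivative (real (n + 2) * max 0 t ^ Suc n)) (at t)"
      using 1 DERIV_pow[of "Suc (Suc n)" t UNIV] by simp
    then show ?thesis
      by (rule has_field_derivative_transform_within_open[of _ _ _ "{0<..}"]) (use 1 in auto)
  next
    case 2
    have "((\<lambda>t::real. 0) has_real_derivative (real (n + 2) * max 0 t ^ Suc n)) (at t)"
      using 2 by auto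
    then show ?thesis
      by (rule has_field_derivative_transform_within_open[of _ _ _ "{..<0}"]) (use 2 in auto)
  next
    case 3
    \<comment> \<open>At the kink the difference quotient is at most
      \<open>\<bar>h\<bar> ^ Suc n\<close>, which vanishes with \<open>h\<close> because the
      exponent of the truncated power is at least 2.\<close>
    have "((\<lambda>h::real. max 0 h ^ Suc (Suc n) / h) \<longlongrightarrow> 0) (at 0)"
    proof (rule Lim_null_comparison)
      have "norm (max 0 h ^ Suc (Suc n) / h) \<le> \<bar>h\<bar> ^ Suc n" for h :: real
      proof (cases "h \<le> 0")
        case True
        then have "max 0 h = 0" by simp
        then show ?thesis by (simp del: power_Suc add: power_0_Suc)
      qed simp
      then show "\<forall>\<^sub>F h in at 0. norm (max 0 h ^ Suc (Suc n) / h) \<le> \<bar>h::real\<bar> ^ Suc n"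
        by simp
      show "((\<lambda>h::real. \<bar>h\<bar> ^ Suc n) \<longlongrightarrow> 0) (at 0)"
        by (auto intro!: tendsto_eq_intros)
    qed
    then show ?thesis using 3 by (simp add: DERIV_def)
  qed
qed

text \<open>\<open>S'\<close> is the quadratic cardinal B-spline on [0, 3], a third difference of
  truncated squares, and \<open>S\<close> is its antiderivative. A spline of this degree is just
  smooth enough: \<open>S''\<close> is piecewise linear and continuous, as integration by parts of
  \<open>S'\<close> demands.\<close>

lemma smooth_step:
  obtains S S' S'' :: "real \<Rightarrow> real"
  where "\<And>t. (S has_real_derivative S' t) (at t)" "\<And>t. (S' has_real_derivative S'' t) (at t)"
    "\<And>t. isCont S'' t" "\<And>t. 0 \<le> S t" "\<And>t. S t \<le> 1" "\<And>t. \<bar>S' t\<bar> \<le> 1" "\<And>t. \<bar>S'' t\<bar> \<le> 1"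
    "\<And>t. t \<le> 0 \<Longrightarrow> S t = 0" "\<And>t. t \<ge> 3 \<Longrightarrow> S t = 1" "\<And>t. t \<ge> 3 \<Longrightarrow> S' t = 0"
proof -
  define m :: "real \<Rightarrow> real" where "m = max 0"
  have m0: "m t = 0" if "t \<le> 0" for t using that by (simp add: m_def)
  have m1: "m t = t" if "t \<ge> 0" for t using that by (simp add: m_def)
  define S where "S = (\<lambda>t. (m t ^ 3 - 3 * m (t - 1) ^ 3 + 3 * m (t - 2) ^ 3 - m (t - 3) ^ 3) / 6)"
  define S' where "S' = (\<lambda>t. (m t ^ 2 - 3 * m (t - 1) ^ 2 + 3 * m (t - 2) ^ 2 - m (t - 3) ^ 2) / 2)"
  define S'' where "S'' = (\<lambda>t. m t - 3 * m (t - 1) + 3 * m (t - 2) - m (t - 3))"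
  have m3: "((\<lambda>t. m t ^ 3) has_real_derivative 3 * m t ^ 2) (at t)" for t
    using has_real_derivative_max_0_power[of 1 t] by (simp add: m_def numeral_3_eq_3 numeral_2_eq_2)
  have m2: "((\<lambda>t. m t ^ 2) has_real_derivative 2 * m t) (at t)" for t
    using has_real_derivative_max_0_power[of 0 t] by (simp add: m_def numeral_2_eq_2)
  have shift: "((\<lambda>t. t - c) has_real_derivative 1) (at t)" for c t :: real
    by (auto intro!: derivative_eq_intros)
  have d3: "((\<lambda>t. m (t - c) ^ 3) has_real_derivative 3 * m (t - c) ^ 2) (at t)" for c t
    using DERIV_chain2[where f = "\<lambda>t. m t ^ 3" and g = "\<lambda>t. t - c", OF m3 shift] by simp
  have d2: "((\<lambda>t. m (t - c) ^ 2) has_real_derivative 2 * m (t - c)) (at t)" for c t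
    using DERIV_chain2[where f = "\<lambda>t. m t ^ 2" and g = "\<lambda>t. t - c", OF m2 shift] by simp
  have cases: "t \<le> 0 \<or> (0 \<le> t \<and> t \<le> 1) \<or> (1 \<le> t \<and> t \<le> 2) \<or> (2 \<le> t \<and> t \<le> 3) \<or> 3 \<le> t" for t :: real
    by linarith
  have c1: "S t = 0 \<and> S' t = 0 \<and> S'' t = 0" if "t \<le> 0" for t
    using that by (simp add: S_def S'_def S''_def m0)
  have c2: "S t = t ^ 3 / 6 \<and> S' t = t ^ 2 / 2 \<and> S'' t = t" if "0 \<le> t" "t \<le> 1" for t
    using that by (simp add: S_def S'_def S''_def m0 m1)
  have c3: "S t = (1 + 3 * (t - 1) + 3 * ((t - 1)^2 * (1 - (t - 1))) + (t - 1)^3) / 6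
    \<and> S' t = (1 + 2 * ((t - 1) * (1 - (t - 1)))) / 2 \<and> S'' t = 1 - 2 * (t - 1)"
    if "1 \<le> t" "t \<le> 2" for t
    using that by (simp add: S_def S'_def S''_def m0 m1 power2_eq_square power3_eq_cube algebra_simps)
  have c4: "S t = 1 - (3 - t)^3 / 6 \<and> S' t = (3 - t)^2 / 2 \<and> S'' t = t - 3"
    if "2 \<le> t" "t \<le> 3" for t
    using that by (simp add: S_def S'_def S''_def m0 m1 power2_eq_square power3_eq_cube field_simps)
  have c5: "S t = 1 \<and> S' t = 0 \<and> S'' t = 0" if "3 \<le> t" for t
    using that by (simp add: S_def S'_def S''_def m0 m1 power2_eq_square power3_eq_cube algebra_simps)
  have p: "0 \<le> v ^ n \<and> v ^ n \<le> 1" if "0 \<le> v" "v \<le> 1" for v :: real and n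
    using that by (auto intro: power_le_one)
  have main: "0 \<le> S t \<and> S t \<le> 1 \<and> \<bar>S' t\<bar> \<le> 1 \<and> \<bar>S'' t\<bar> \<le> 1" for t
    using cases[of t]
  proof (elim disjE conjE)
    assume t: "1 \<le> t" "t \<le> 2"
    define v where "v = t - 1"
    have v: "0 \<le> v" "v \<le> 1" using t by (auto simp: v_def)
    have a: "0 \<le> v * (1 - v)" "v * (1 - v) \<le> 1 / 4"
      using v mult_nonneg_nonneg[of v "1 - v"] zero_le_power2[of "v - 1 / 2"]
      by (auto simp: power2_eq_square algebra_simps)
    have b: "0 \<le> v^2 * (1 - v)" "v^2 * (1 - v) \<le> 1 - v"
      using v p[OF v, of 2] mult_right_mono[of "v^2" 1 "1 - v"] by auto
    have c: "v ^ 3 \<le> v" "0 \<le> v ^ 3"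
      using v power_decreasing[of 1 3 v] by auto
    \<comment> \<open>Naming the three nonlinear monomials leaves only linear arithmetic. For
      instance the upper bounds on \<open>q2\<close> and \<open>q3\<close> give
      \<open>S t \<le> (1 + 3 * v + 3 * (1 - v) + v) / 6\<close>, which is at most 5/6.\<close>
    define q1 q2 q3 where "q1 = v * (1 - v)" and "q2 = v^2 * (1 - v)" and "q3 = v ^ 3"
    have e: "S t = (1 + 3 * v + 3 * q2 + q3) / 6" "S' t = (1 + 2 * q1) / 2" "S'' t = 1 - 2 * v"
      using c3[OF t] by (simp_all add: v_def q1_def q2_def q3_def)
    note q = a[folded q1_def] b[folded q2_def] c[folded q3_def] v
    have "0 \<le> S t" "S t \<le> 1" "- 1 \<le> S' t" "S' t \<le> 1" "- 1 \<le> S'' t" "S'' t \<le> 1"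
      unfolding e using q by simp_all
    then show ?thesis by (simp add: abs_le_iff)
  next
    assume t: "0 \<le> t" "t \<le> 1"
    then show ?thesis using p[OF t, of 2] p[OF t, of 3] by (simp add: c2)
  next
    assume t: "2 \<le> t" "t \<le> 3"
    then show ?thesis using p[of "3 - t" 2] p[of "3 - t" 3] by (simp add: c4)
  qed (use c1[of t] c5[of t] in auto)
  show ?thesis
  proof
    show "(S has_real_derivative S' t) (at t)" for t
      unfolding S_def S'_def 
      by (rule DERIV_cong[OF DERIV_cdivide[OF DERIV_diff[OF DERIV_add[OF DERIV_diff[OF m3
        DERIV_cmult[OF d3]] DERIV_cmult[OF d3]] d3]]]) simp
    show "(S' has_real_derivative S'' t) (at t)" for t
      unfolding S'_def S''_def 
      by (rule DERIV_cong[OF DERIV_cdivide[OF DERIV_diff[OF DERIV_add[OF DERIV_diff[OF m2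
        DERIV_cmult[OF d2]] DERIV_cmult[OF d2]] d2]]]) simp
    show "isCont S'' t" for t
      unfolding S''_def m_def by (intro continuous_intros)
  qed (use main c1 c5 in auto)
qed

text \<open>A descending step on the right and its mirror image on the left, each rescaled by
  \<open>k = 3 / (v - u)\<close> to fit the window. As \<open>0 \<le> u\<close>, one of the two
  steps equals 1 at every point, so subtracting 1 from their sum leaves the other. The slope is
  bounded explicitly by \<open>2 * k\<close> since it enters the final error; for \<open>g''\<close>
  any finite bound serves.\<close>

lemma smooth_cutoff:
  assumes uv: "0 \<le> u" "u < v"
  obtains g g' g'' :: "real \<Rightarrow> real" and C :: real
  where "\<And>x. (g has_real_derivative g' x) (at x)" "\<And>x. (g' has_real_derivative g'' x) (at x)"
    "\<And>x. isCont g'' x" "\<And>x. 0 \<le> g x" "\<And>x. g x \<le> 1" "\<And>x. \<bar>g' x\<bar> \<le> 6 / (v - u)" "\<And>x. \<bar>g'' x\<bar> \<le> C"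
    "\<And>x. \<bar>x\<bar> \<le> u \<Longrightarrow> g x = 1" "\<And>x. v \<le> \<bar>x\<bar> \<Longrightarrow> g x = 0" "\<And>x. \<bar>x\<bar> < u \<Longrightarrow> g' x = 0"
proof -
  obtain S S' S'' :: "real \<Rightarrow> real"
  where S: "\<And>t. (S has_real_derivative S' t) (at t)" "\<And>t. (S' has_real_derivative S'' t) (at t)"
    "\<And>t. isCont S'' t" "\<And>t. 0 \<le> S t" "\<And>t. S t \<le> 1" "\<And>t. \<bar>S' t\<bar> \<le> 1" "\<And>t. \<bar>S'' t\<bar> \<le> 1"
    "\<And>t. t \<le> 0 \<Longrightarrow> S t = 0" "\<And>t. t \<ge> 3 \<Longrightarrow> S t = 1" "\<And>t. t \<ge> 3 \<Longrightarrow> S' t = 0"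
    using smooth_step by metis
  define k where "k = 3 / (v - u)"
  have k: "k > 0" using uv by (simp add: k_def)
  have k3: "k * (v - y) \<ge> 3 \<longleftrightarrow> y \<le> u" for y
    using uv by (simp add: k_def field_simps)
  have k0: "k * (v - y) \<le> 0 \<longleftrightarrow> v \<le> y" for y
    using k by (simp add: mult_le_0_iff)
  define g where "g = (\<lambda>x. S (k * (v - x)) + S (k * (v + x)) - 1)"
  define g' where "g' = (\<lambda>x. k * (S' (k * (v + x)) - S' (k * (v - x))))"
  define g'' where "g'' = (\<lambda>x. k * (k * (S'' (k * (v + x)) + S'' (k * (v - x)))))"
  have L: "((\<lambda>x. k * (v - x)) has_real_derivative - k) (at x)"
    "((\<lambda>x. k * (v + x)) has_real_derivative k) (at x)" for x
    by (auto intro!: derivative_eq_intros)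
  have one: "S (k * (v - x)) = 1 \<or> S (k * (v + x)) = 1" for x
    using k3[of x] k3[of "- x"] S(9) uv by (cases "x \<le> 0") auto
  show ?thesis
  proof (rule that)
    show "(g has_real_derivative g' x) (at x)" for x
      unfolding g_def g'_def
      by (auto intro!: derivative_eq_intros DERIV_chain2[OF S(1)] L simp: algebra_simps)
    show "(g' has_real_derivative g'' x) (at x)" for x
      unfolding g''_def g'_def
      by (auto intro!: derivative_eq_intros DERIV_chain2[OF S(2)] L simp: algebra_simps)
    show "isCont g'' x" for x
      unfolding g''_def by (intro continuous_intros isCont_o2[OF _ S(3)])
    show "0 \<le> g x" "g x \<le> 1" for x
      using one[of x] S(4,5)[of "k * (v - x)"] S(4,5)[of "k * (v + x)"] by (auto simp: g_def)
    show "\<bar>g' x\<bar> \<le> 6 / (v - u)" for x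
    proof -
      have "\<bar>S' (k * (v + x)) - S' (k * (v - x))\<bar> \<le> 2"
        using S(6)[of "k * (v - x)"] S(6)[of "k * (v + x)"] by linarith
      then have "\<bar>g' x\<bar> \<le> k * 2" using k by (simp add: g'_def abs_mult)
      then show ?thesis by (simp add: k_def)
    qed
    show "\<bar>g'' x\<bar> \<le> k * (2 * k)" for x
    proof -
      have "\<bar>S'' (k * (v + x)) + S'' (k * (v - x))\<bar> \<le> 2"
        using S(7)[of "k * (v - x)"] S(7)[of "k * (v + x)"] by linarith
      then have "k * (k * \<bar>S'' (k * (v + x)) + S'' (k * (v - x))\<bar>) \<le> k * (k * 2)"
        using k by (intro mult_left_mono) auto
      then show ?thesis using k by (simp add: g''_def abs_mult mult.commute)
    qed
    show "g x = 1" if "\<bar>x\<bar> \<le> u" for x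
      using that k3[of x] k3[of "- x"] S(9) by (auto simp: g_def abs_le_iff)
    show "g x = 0" if "v \<le> \<bar>x\<bar>" for x
      using that k3[of x] k3[of "- x"] k0[of x] k0[of "- x"] S(8,9) uv
      by (cases "x \<ge> 0") (auto simp: g_def)
    show "g' x = 0" if "\<bar>x\<bar> < u" for x
      using that k3[of x] k3[of "- x"] S(10) by (auto simp: g'_def abs_less_iff)
  qed
qed

subsection \<open>The Gaussian comparison inequality\<close>

lemma inner_on_lincomb:
  "inner_on J (\<lambda>j. s * a j + t * b j) x = s * inner_on J a x + t * inner_on J b x"
  by (simp add: inner_on_def sum.distrib sum_distrib_left algebra_simps)

lemma inner_on_lincomb_right:
  "inner_on J x (\<lambda>j. s * a j + t * b j) = s * inner_on J x a + t * inner_on J x b"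
  by (simp add: inner_on_def sum.distrib sum_distrib_left algebra_simps)

lemma inner_on_scale:
  "inner_on J (\<lambda>j. s * a j) x = s * inner_on J a x"
  "inner_on J x (\<lambda>j. s * a j) = s * inner_on J x a"
  by (simp_all add: inner_on_def sum_distrib_left mult_ac)

lemma inner_on_commute: "inner_on J a b = inner_on J b a"
  by (simp add: inner_on_def mult.commute)

lemma sum_power2_eq_inner_on: "(\<Sum>j\<in>J. (a j)\<^sup>2) = inner_on J a a"
  by (simp add: inner_on_def power2_eq_square)

lemma gauss_abs_tail:
  assumes J: "finite J" and a: "inner_on J a a = 1" and u: "0 \<le> u"
  shows "measure (gauss J) {x \<in> space (gauss J). u \<le> \<bar>inner_on J a x\<bar>} \<le> 2 * exp (- u\<^sup>2 / 2)"
proof -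
  interpret prob_space "gauss J" by (rule prob_space_gauss)
  define E where "E = (\<lambda>s::real. {x \<in> space (gauss J). u \<le> inner_on J (\<lambda>j. s * a j) x})"
  have E: "measure (gauss J) (E s) \<le> exp (- u\<^sup>2 / 2)" if "\<bar>s\<bar> = 1" for s
    using gauss_tail[OF J, of "\<lambda>j. s * a j" 1 u] that u abs_mult_self_eq[of s]
    by (simp add: E_def sum_power2_eq_inner_on inner_on_scale a)
  have "measure (gauss J) {x \<in> space (gauss J). u \<le> \<bar>inner_on J a x\<bar>} \<le> measure (gauss J) (E 1 \<union> E (-1))"
    by (rule finite_measure_mono) (auto simp: E_def inner_on_scale abs_real_def split: if_splits)
  also have "\<dots> \<le> measure (gauss J) (E 1) + measure (gauss J) (E (-1))"
    by (rule measure_Un_le) (auto simp: E_def)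
  finally show ?thesis using E[of 1] E[of "-1"] by simp
qed

text \<open>If both coefficients exceed \<open>u\<close> in modulus, then for suitable signs the
  signed sum is at least \<open>2 * u\<close>. Its variance is at most \<open>2 + 2 * k\<close>, so
  the Chernoff exponent is u^2/(1+k); the factor 4 counts the sign choices. A single tail would give
  only half of u^2.\<close>

lemma gauss_pair_tail:
  assumes J: "finite J" and ab: "inner_on J a a = 1" "inner_on J b b = 1"
    and k: "\<bar>inner_on J a b\<bar> \<le> k" and u: "0 \<le> u"
  shows "measure (gauss J) {x \<in> space (gauss J). u \<le> \<bar>inner_on J a x\<bar> \<and> u \<le> \<bar>inner_on J b x\<bar>}
    \<le> 4 * exp (- u\<^sup>2 / (1 + k))"
proof -
  interpret prob_space "gauss J" by (rule prob_space_gauss)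
  define E where "E = (\<lambda>(s::real, t::real). {x \<in> space (gauss J). 2 * u \<le> inner_on J (\<lambda>j. s * a j + t * b j) x})"
  let ?S = "{1, -1::real} \<times> {1, -1::real}"
  have k0: "0 \<le> k" using k by linarith
  have E: "measure (gauss J) (E p) \<le> exp (- u\<^sup>2 / (1 + k))" if "p \<in> ?S" for p
  proof -
    obtain s t where p: "p = (s, t)" by force
    have "inner_on J (\<lambda>j. s * a j + t * b j) (\<lambda>j. s * a j + t * b j) \<le> 2 + 2 * k"
      using that k
      by (auto simp: p inner_on_lincomb inner_on_lincomb_right inner_on_commute[of J b a] ab abs_le_iff)
    then have "measure (gauss J) (E p) \<le> exp (- (2 * u)\<^sup>2 / (2 * (2 + 2 * k)))"
      using gauss_tail[OF J, of "\<lambda>j. s * a j + t * b j" "2 + 2 * k" "2 * u"] u k0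
      by (simp add: E_def p sum_power2_eq_inner_on)
    also have "- (2 * u)\<^sup>2 / (2 * (2 + 2 * k)) = - u\<^sup>2 / (1 + k)"
      using k0 by (simp add: field_simps)
    finally show ?thesis .
  qed
  have "measure (gauss J) {x \<in> space (gauss J). u \<le> \<bar>inner_on J a x\<bar> \<and> u \<le> \<bar>inner_on J b x\<bar>}
      \<le> measure (gauss J) (\<Union>p\<in>?S. E p)"
    by (rule finite_measure_mono)
      (auto simp: E_def inner_on_lincomb abs_real_def split: if_splits)
  also have "\<dots> \<le> (\<Sum>p\<in>?S. measure (gauss J) (E p))"
    by (rule measure_UNION_le) (auto simp: E_def)
  also have "\<dots> \<le> (\<Sum>p\<in>?S. exp (- u\<^sup>2 / (1 + k)))"
    by (intro sum_mono E)
  also have "\<dots> = 4 * exp (- u\<^sup>2 / (1 + k))" by (simp add: card_cartesian_product)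
  finally show ?thesis .
qed

lemma integrable_inner_on_gauss:
  assumes "finite J"
  shows "integrable (gauss J) (inner_on J a)"
proof -
  have "integrable (gauss J) (\<lambda>x. x j)" if "j \<in> J" for j
    using integrable_gauss_component_times[OF that, of "\<lambda>_. 1" 1] by simp
  then show ?thesis unfolding inner_on_def[abs_def] by auto
qed

text \<open>Mutual orthogonality of \<open>A\<close> and \<open>B\<close> makes the two families
  independent on one Gaussian space. Integration by parts produces the correlation of velocity and
  position on the path, which is \<open>sin t * cos t\<close> times the difference of the
  \<open>A\<close>- and \<open>B\<close>-correlations: zero for equal indices, at most the
  \<open>A\<close>-correlation in modulus otherwise. The constant 8 is the 4 of
  \<open>gauss_pair_tail\<close> times an upper bound 2 for \<open>pi / 2\<close>.\<close>

lemma gauss_comparison: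
  fixes A B :: "'w \<Rightarrow> 'j \<Rightarrow> real" and g g' g'' :: "real \<Rightarrow> real"
  assumes J: "finite J" and W: "finite W"
    and A: "\<And>v. v \<in> W \<Longrightarrow> inner_on J (A v) (A v) = 1"
    and B: "\<And>v. v \<in> W \<Longrightarrow> inner_on J (B v) (B v) = 1"
    and B_orth: "\<And>v w. v \<in> W \<Longrightarrow> w \<in> W \<Longrightarrow> v \<noteq> w \<Longrightarrow> inner_on J (B v) (B w) = 0"
    and AB: "\<And>v w. v \<in> W \<Longrightarrow> w \<in> W \<Longrightarrow> inner_on J (A v) (B w) = 0"
    and g: "\<And>x. (g has_real_derivative g' x) (at x)" "\<And>x. (g' has_real_derivative g'' x) (at x)"
      "\<And>x. isCont g'' x" "\<And>x. 0 \<le> g x" "\<And>x. g x \<le> 1" "\<And>x. \<bar>g' x\<bar> \<le> D" "\<And>x. \<bar>g'' x\<bar> \<le> C"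
    and supp: "\<And>x. \<bar>x\<bar> < u \<Longrightarrow> g' x = 0" and u: "0 \<le> u"
  shows "\<bar>(LINT x|gauss J. (\<Prod>v\<in>W. g (inner_on J (A v) x))) -
      (LINT x|gauss J. (\<Prod>v\<in>W. g (inner_on J (B v) x)))\<bar>
    \<le> 8 * D\<^sup>2 * (\<Sum>v\<in>W. \<Sum>w\<in>W - {v}. \<bar>inner_on J (A v) (A w)\<bar> *
        exp (- u\<^sup>2 / (1 + \<bar>inner_on J (A v) (A w)\<bar>)))"
proof -
  interpret prob_space "gauss J" by (rule prob_space_gauss)
  have D0: "0 \<le> D" using g(6)[of 0] by linarith
  have gc: "isCont g x" "isCont g' x" for x
    using g(1,2)[of x] by (auto intro: DERIV_isCont)
  have [measurable]: "g \<in> borel_measurable borel" "g' \<in> borel_measurable borel" "g'' \<in> borel_measurable borel"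
    using gc g(3) by (auto intro!: borel_measurable_continuous_onI continuous_at_imp_continuous_on)
  have gprod: "\<bar>\<Prod>v\<in>S. g (f v)\<bar> \<le> 1" for f :: "'w \<Rightarrow> real" and S
    unfolding abs_prod using g(4,5) by (intro prod_le_1) auto
  define \<kappa> where "\<kappa> = (\<lambda>v w. \<bar>inner_on J (A v) (A w)\<bar>)"
  \<comment> \<open>Moving along a quarter circle keeps every coefficient at unit variance, and the
    velocity \<open>P'\<close> stays bounded up to both endpoints, unlike interpolation with square
    roots of the time.\<close>
  define P where "P = (\<lambda>t v j. cos t * B v j + sin t * A v j)"
  define P' where "P' = (\<lambda>t v j. (- sin t) * B v j + cos t * A v j)"
  have Pi: "inner_on J (P t v) x = cos t * inner_on J (B v) x + sin t * inner_on J (A v) x" for t v x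
    unfolding P_def by (rule inner_on_lincomb)
  have P'i: "inner_on J (P' t v) x = (- sin t) * inner_on J (B v) x + cos t * inner_on J (A v) x" for t v x
    unfolding P'_def by (rule inner_on_lincomb)
  have Pr: "inner_on J x (P t v) = cos t * inner_on J x (B v) + sin t * inner_on J x (A v)" for t v x
    unfolding P_def by (rule inner_on_lincomb_right)
  have sc: "cos t * cos t + sin t * sin t = 1" for t :: real
    using sin_cos_squared_add3[of t] by (simp add: add.commute)
  have BA: "inner_on J (B v) (A w) = 0" if "v \<in> W" "w \<in> W" for v w
    using AB[OF that(2,1)] by (simp add: inner_on_commute)
  have inner_P: "inner_on J (P t v) (P t w) = cos t * cos t * inner_on J (B v) (B w) + sin t * sin t * inner_on J (A v) (A w)"
    if "v \<in> W" "w \<in> W" for t v w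
    using that by (simp add: Pi Pr AB BA)
  have inner_P': "inner_on J (P' t v) (P t w) = sin t * cos t * (inner_on J (A v) (A w) - inner_on J (B v) (B w))"
    if "v \<in> W" "w \<in> W" for t v w
    using that by (simp add: P'i Pr AB BA algebra_simps)
  define f where "f = (\<lambda>t x. \<Prod>v\<in>W. g (inner_on J (P t v) x))"
  \<comment> \<open>One summand of the time derivative. The updated function places
    \<open>g'\<close> in slot \<open>v\<close>, which is the form that
    \<open>gauss_integration_by_parts\<close> accepts.\<close>
  define T where "T = (\<lambda>t v x. inner_on J (P' t v) x * (\<Prod>w\<in>W. ((\<lambda>_. g)(v := g')) w (inner_on J (P t w) x)))"
  have Tv: "T t v x = g' (inner_on J (P t v) x) * inner_on J (P' t v) x * (\<Prod>w\<in>W - {v}. g (inner_on J (P t w) x))"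
    if "v \<in> W" for t v x
  proof -
    have "(\<Prod>w\<in>W. ((\<lambda>_. g)(v := g')) w (inner_on J (P t w) x)) =
        g' (inner_on J (P t v) x) * (\<Prod>w\<in>W - {v}. ((\<lambda>_. g)(v := g')) w (inner_on J (P t w) x))"
      using W that by (subst prod.remove[of _ v]) auto
    also have "(\<Prod>w\<in>W - {v}. ((\<lambda>_. g)(v := g')) w (inner_on J (P t w) x)) =
        (\<Prod>w\<in>W - {v}. g (inner_on J (P t w) x))"
      by (rule prod.cong) auto
    finally show ?thesis by (simp add: T_def mult_ac)
  qed
  have Tm: "T t v \<in> borel_measurable (gauss J)" for t v
  proof -
    have "((\<lambda>_. g)(v := g')) w \<in> borel_measurable borel" for w by (cases "w = v") auto
    then show ?thesis unfolding T_def by measurable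
  qed
  have Tb: "\<bar>T t v x\<bar> \<le> D * (\<bar>inner_on J (B v) x\<bar> + \<bar>inner_on J (A v) x\<bar>)" if "v \<in> W" for t v x
  proof -
    have "\<bar>inner_on J (P' t v) x\<bar> \<le> \<bar>inner_on J (B v) x\<bar> + \<bar>inner_on J (A v) x\<bar>"
    proof -
      have "\<bar>inner_on J (P' t v) x\<bar> \<le> \<bar>sin t\<bar> * \<bar>inner_on J (B v) x\<bar> + \<bar>cos t\<bar> * \<bar>inner_on J (A v) x\<bar>"
        unfolding P'i by (rule order.trans[OF abs_triangle_ineq]) (simp add: abs_mult)
      also have "\<dots> \<le> 1 * \<bar>inner_on J (B v) x\<bar> + 1 * \<bar>inner_on J (A v) x\<bar>"
        by (intro add_mono mult_right_mono) auto
      finally show ?thesis by simp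
    qed
    then have "\<bar>T t v x\<bar> \<le> D * (\<bar>inner_on J (B v) x\<bar> + \<bar>inner_on J (A v) x\<bar>) * 1"
      unfolding Tv[OF that] abs_mult using g(6) gprod D0 by (intro mult_mono) auto
    then show ?thesis by simp
  qed
  have wi: "integrable (gauss J) (\<lambda>x. \<Sum>v\<in>W. D * (\<bar>inner_on J (B v) x\<bar> + \<bar>inner_on J (A v) x\<bar>))"
    using integrable_inner_on_gauss[OF J] by auto
  have Ti: "integrable (gauss J) (T t v)" if "v \<in> W" for t v
  proof (rule Bochner_Integration.integrable_bound[OF _ Tm])
    show "integrable (gauss J) (\<lambda>x. D * (\<bar>inner_on J (B v) x\<bar> + \<bar>inner_on J (A v) x\<bar>))"
      using integrable_inner_on_gauss[OF J] by auto
    show "AE x in gauss J. norm (T t v x) \<le> norm (D * (\<bar>inner_on J (B v) x\<bar> + \<bar>inner_on J (A v) x\<bar>))"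
      using Tb[OF that] D0 by (simp add: abs_mult)
  qed
  have deriv: "((\<lambda>t. LINT x|gauss J. f t x) has_real_derivative (LINT x|gauss J. (\<Sum>v\<in>W. T t v x))) (at t)" for t
  proof (rule has_real_derivative_integral[OF _ _ _ _ wi])
    show "((\<lambda>t. f t x) has_real_derivative (\<Sum>v\<in>W. T t v x)) (at t)" for t x
    proof -
      have "((\<lambda>t. g (inner_on J (P t v) x)) has_real_derivative
          g' (inner_on J (P t v) x) * inner_on J (P' t v) x) (at t)" for v
        unfolding Pi P'i
        by (rule DERIV_chain2[OF g(1)]) (auto intro!: derivative_eq_intros)
      from has_field_derivative_prod[OF this]
      have "((\<lambda>t. f t x) has_real_derivative (\<Sum>v\<in>W. g' (inner_on J (P t v) x) * inner_on J (P' t v) x *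
          (\<Prod>w\<in>W - {v}. g (inner_on J (P t w) x)))) (at t)"
        unfolding f_def .
      then show ?thesis by (simp add: Tv)
    qed
    show "integrable (gauss J) (f t)" for t
      unfolding f_def by (rule integrable_gauss_bounded[of _ _ 1]) (use gprod in auto)
    show "(\<lambda>x. \<Sum>v\<in>W. T t v x) \<in> borel_measurable (gauss J)" for t
      using Tm by measurable
    show "\<bar>\<Sum>v\<in>W. T t v x\<bar> \<le> (\<Sum>v\<in>W. D * (\<bar>inner_on J (B v) x\<bar> + \<bar>inner_on J (A v) x\<bar>))" for t x
      using Tb by (intro order.trans[OF sum_abs] sum_mono)
  qed
  have T_int: "\<bar>LINT x|gauss J. T t v x\<bar> \<le> (\<Sum>w\<in>W - {v}. \<kappa> v w * (D\<^sup>2 * (4 * exp (- u\<^sup>2 / (1 + \<kappa> v w)))))"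
    if v: "v \<in> W" for t v
  proof -
    let ?h = "(\<lambda>_. g)(v := g')" and ?h' = "(\<lambda>_. g')(v := g'')"
    define K where "K = (\<lambda>w x. ?h' w (inner_on J (P t w) x) * (\<Prod>y\<in>W - {w}. ?h y (inner_on J (P t y) x)))"
    have "(LINT x|gauss J. T t v x) = (\<Sum>w\<in>W. inner_on J (P' t v) (P t w) * (LINT x|gauss J. K w x))"
      unfolding T_def K_def
    proof (rule gauss_integration_by_parts[OF J W])
      show "(?h w has_real_derivative ?h' w x) (at x)" for w x using g(1,2) by auto
      show "isCont (?h' w) x" for w x using g(3) gc by auto
      show "\<bar>?h w x\<bar> \<le> 1 + D + C" for w x
        using g(4)[of x] g(5)[of x] g(6)[of x] g(7)[of x] by auto
      show "\<bar>?h' w x\<bar> \<le> 1 + D + C" for w x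
        using g(4)[of x] g(5)[of x] g(6)[of x] g(7)[of x] by auto
    qed
    \<comment> \<open>The diagonal term, which carries \<open>g''\<close>, drops out because \<open>P t v\<close> has constant norm.\<close>
    also have "\<dots> = (\<Sum>w\<in>W - {v}. inner_on J (P' t v) (P t w) * (LINT x|gauss J. K w x))"
      using W v A[OF v] B[OF v] by (subst sum.remove[of _ v]) (auto simp: inner_P')
    also have "\<bar>\<dots>\<bar> \<le> (\<Sum>w\<in>W - {v}. \<kappa> v w * (D\<^sup>2 * (4 * exp (- u\<^sup>2 / (1 + \<kappa> v w)))))"
    proof (intro order.trans[OF sum_abs] sum_mono)
      fix w assume "w \<in> W - {v}"
      then have w: "w \<in> W" "w \<noteq> v" by auto
      \<comment> \<open>Off-diagonal terms contain \<open>g'\<close> at both indices, and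
        \<open>g'\<close> vanishes inside \<open>(- u, u)\<close>. Hence the integrand lives on the
        joint exceedance event, whose probability \<open>gauss_pair_tail\<close> bounds.\<close>
      let ?E = "{x \<in> space (gauss J). u \<le> \<bar>inner_on J (P t v) x\<bar> \<and> u \<le> \<bar>inner_on J (P t w) x\<bar>}"
      have Em: "?E \<in> sets (gauss J)" by measurable
      have Kb: "\<bar>K w x\<bar> \<le> D\<^sup>2 * indicator ?E x" if "x \<in> space (gauss J)" for x
      proof -
        have "K w x = g' (inner_on J (P t w) x) * (g' (inner_on J (P t v) x) *
            (\<Prod>y\<in>W - {w} - {v}. ?h y (inner_on J (P t y) x)))"
          unfolding K_def using W v w by (subst prod.remove[of _ v]) auto
        also have "(\<Prod>y\<in>W - {w} - {v}. ?h y (inner_on J (P t y) x)) =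
            (\<Prod>y\<in>W - {w} - {v}. g (inner_on J (P t y) x))"
          by (rule prod.cong) auto
        finally have K: "K w x = g' (inner_on J (P t w) x) * (g' (inner_on J (P t v) x) *
            (\<Prod>y\<in>W - {w} - {v}. g (inner_on J (P t y) x)))" .
        show ?thesis
        proof (cases "x \<in> ?E")
          case True
          have "\<bar>K w x\<bar> \<le> D * (D * 1)"
            unfolding K abs_mult using g(6) gprod D0 by (intro mult_mono) auto
          then show ?thesis using True by (simp add: power2_eq_square)
        next
          case False
          then have "K w x = 0" using that supp unfolding K by (auto simp: not_le)
          then show ?thesis by simp
        qed
      qed
      have Km: "K w \<in> borel_measurable (gauss J)"
      proof -
        have "?h y \<in> borel_measurable borel" "?h' y \<in> borel_measurable borel" for y by auto
        then show ?thesis unfolding K_def by measurable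
      qed
      have "\<bar>LINT x|gauss J. K w x\<bar> \<le> (LINT x|gauss J. D\<^sup>2 * indicator ?E x)"
      proof (rule order.trans[OF integral_abs_bound], rule integral_mono)
        show i: "integrable (gauss J) (\<lambda>x. D\<^sup>2 * indicator ?E x :: real)"
          using Em by (intro integrable_mult_right integrable_real_indicator) (auto simp: emeasure_eq_measure)
        have "integrable (gauss J) (K w)"
          by (rule Bochner_Integration.integrable_bound[OF i Km]) (use Kb in auto)
        then show "integrable (gauss J) (\<lambda>x. \<bar>K w x\<bar>)" by (rule integrable_abs)
      qed (use Kb in auto)
      also have "\<dots> = D\<^sup>2 * measure (gauss J) ?E" using Em by simp
      also have "measure (gauss J) ?E \<le> 4 * exp (- u\<^sup>2 / (1 + \<kappa> v w))"
      proof (rule gauss_pair_tail[OF J _ _ _ u])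
        show "inner_on J (P t v) (P t v) = 1" "inner_on J (P t w) (P t w) = 1"
          using v w A B sc by (simp_all add: inner_P)
        have "\<bar>sin t\<bar> * \<bar>sin t\<bar> \<le> 1 * 1" by (intro mult_mono) auto
        then have "\<bar>sin t\<bar> * \<bar>sin t\<bar> * \<kappa> v w \<le> 1 * \<kappa> v w"
          by (intro mult_right_mono) (auto simp: \<kappa>_def)
        then show "\<bar>inner_on J (P t v) (P t w)\<bar> \<le> \<kappa> v w"
          using v w B_orth[of v w] by (simp add: inner_P abs_mult \<kappa>_def)
      qed
      finally have Ki: "\<bar>LINT x|gauss J. K w x\<bar> \<le> D\<^sup>2 * (4 * exp (- u\<^sup>2 / (1 + \<kappa> v w)))"
        by (simp add: mult_left_mono)
      have "\<bar>inner_on J (P' t v) (P t w)\<bar> \<le> \<kappa> v w"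
      proof -
        have "\<bar>sin t\<bar> * \<bar>cos t\<bar> \<le> 1 * 1" by (intro mult_mono) auto
        then have "\<bar>sin t\<bar> * \<bar>cos t\<bar> * \<kappa> v w \<le> 1 * \<kappa> v w"
          by (intro mult_right_mono) (auto simp: \<kappa>_def)
        then show ?thesis
          using v w B_orth[of v w] by (simp add: inner_P' abs_mult \<kappa>_def)
      qed
      then show "\<bar>inner_on J (P' t v) (P t w) * (LINT x|gauss J. K w x)\<bar>
          \<le> \<kappa> v w * (D\<^sup>2 * (4 * exp (- u\<^sup>2 / (1 + \<kappa> v w))))"
        unfolding abs_mult using Ki by (intro mult_mono) (auto simp: \<kappa>_def)
    qed
    finally show ?thesis .
  qed
  let ?R = "\<Sum>v\<in>W. \<Sum>w\<in>W - {v}. \<kappa> v w * exp (- u\<^sup>2 / (1 + \<kappa> v w))"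
  have db: "\<bar>LINT x|gauss J. (\<Sum>v\<in>W. T t v x)\<bar> \<le> 4 * D\<^sup>2 * ?R" for t
  proof -
    have "\<bar>LINT x|gauss J. (\<Sum>v\<in>W. T t v x)\<bar> = \<bar>\<Sum>v\<in>W. LINT x|gauss J. T t v x\<bar>"
      using Ti by (subst Bochner_Integration.integral_sum) auto
    also have "\<dots> \<le> (\<Sum>v\<in>W. \<Sum>w\<in>W - {v}. \<kappa> v w * (D\<^sup>2 * (4 * exp (- u\<^sup>2 / (1 + \<kappa> v w)))))"
      using T_int by (intro order.trans[OF sum_abs] sum_mono)
    also have "\<dots> = 4 * D\<^sup>2 * ?R" by (simp add: sum_distrib_left mult_ac)
    finally show ?thesis .
  qed
  have R0: "0 \<le> ?R" by (intro sum_nonneg mult_nonneg_nonneg) (auto simp: \<kappa>_def)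
  have "norm ((LINT x|gauss J. f (pi / 2) x) - (LINT x|gauss J. f 0 x)) \<le> (4 * D\<^sup>2 * ?R) * norm (pi / 2 - 0)"
    by (rule field_differentiable_bound[of UNIV _ "\<lambda>t. LINT x|gauss J. (\<Sum>v\<in>W. T t v x)"])
      (use deriv db in auto)
  \<comment> \<open>The path starts at \<open>B\<close> for time 0 and reaches \<open>A\<close> at
    time \<open>pi / 2\<close>; its length is rounded up to 2.\<close>
  also have "\<dots> \<le> (4 * D\<^sup>2 * ?R) * 2"
    using pi_less_4 R0 by (intro mult_left_mono) auto
  finally show ?thesis
    by (simp add: f_def Pi \<kappa>_def)
qed

subsection \<open>Gumbel asymptotics\<close>

text \<open>The threshold of the theorem divided by \<sigma>. It takes a real \<open>N\<close>, so
  that its asymptotics are limits at infinity over the reals, composed only later with the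
  cardinalities.\<close>

definition gumbel_level :: "real \<Rightarrow> real \<Rightarrow> real" where
  "gumbel_level z N = sqrt (2 * ln N) + (2 * z - ln (ln N) - ln pi) / (2 * sqrt (2 * ln N))"

lemma gumbel_level_shift:
  assumes "1 < N"
  shows "gumbel_level (z + \<delta>) N = gumbel_level z N + \<delta> / sqrt (2 * ln N)"
  using assms by (simp add: gumbel_level_def field_simps)

text \<open>The cross term of the square is exactly the numerator of the correction; only the square
  of the correction is discarded. What remains has an exponential that is a product of powers of
  \<open>N\<close> and \<open>ln N\<close>.\<close>

lemma gumbel_level_power2_ge:
  assumes "1 < N"
  shows "2 * ln N + (2 * z - ln (ln N) - ln pi) \<le> (gumbel_level z N)\<^sup>2"
proof -
  have "(gumbel_level z N)\<^sup>2 = 2 * ln N + (2 * z - ln (ln N) - ln pi)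
      + ((2 * z - ln (ln N) - ln pi) / (2 * sqrt (2 * ln N)))\<^sup>2"
    using assms by (simp add: gumbel_level_def power2_sum)
  then show ?thesis by simp
qed

lemma exp_gumbel_level_le:
  assumes "1 < N"
  shows "exp (- (gumbel_level z N)\<^sup>2 / 2) \<le> exp (- z) * sqrt (pi * ln N) / N"
proof -
  have L: "0 < ln N" using assms by simp
  have "exp (- (gumbel_level z N)\<^sup>2 / 2) \<le> exp (- ln N - z + ln (pi * ln N) / 2)"
    using gumbel_level_power2_ge[OF assms, of z] L by (simp add: ln_mult field_simps)
  also have "\<dots> = exp (- z) * exp (ln (pi * ln N) / 2) / exp (ln N)"
    by (simp add: algebra_simps flip: exp_add exp_diff)
  also have "exp (ln (pi * ln N) / 2) = sqrt (pi * ln N)"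
    using L by (simp add: ln_sqrt[symmetric])
  finally show ?thesis using assms by simp
qed

lemma filterlim_gumbel_level: "filterlim (gumbel_level z) at_top at_top"
  unfolding gumbel_level_def[abs_def] by real_asymp

text \<open>With \<open>r\<close> the correction term, expanding the square is exact and the
  expression equals \<open>exp (- z)\<close> times \<open>sqrt (2 * ln N) / gumbel_level z N\<close>
  times the exponential of minus r^2/2. The last two factors tend to 1. The terms
  \<open>ln (ln N)\<close> and \<open>ln pi\<close> of the level cancel the prefactor of the normal
  tail.\<close>

lemma gumbel_level_density_limit:
  "((\<lambda>N. N * (2 * std_normal_density (gumbel_level z N) / gumbel_level z N)) \<longlongrightarrow> exp (- z)) at_top"
proof (rule Lim_transform_eventually)
  define r where "r = (\<lambda>N. (2 * z - ln (ln N) - ln pi) / (2 * sqrt (2 * ln N)))"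
  have "((\<lambda>N. sqrt (2 * ln N) / gumbel_level z N) \<longlongrightarrow> 1) at_top"
    unfolding gumbel_level_def[abs_def] by real_asymp
  note 1 = this
  have 2: "((\<lambda>N. exp (- (r N)\<^sup>2 / 2)) \<longlongrightarrow> 1) at_top"
    unfolding r_def by real_asymp
  show "((\<lambda>N. exp (- z) * (sqrt (2 * ln N) / gumbel_level z N) * exp (- (r N)\<^sup>2 / 2)) \<longlongrightarrow> exp (- z)) at_top"
    using tendsto_mult[OF tendsto_mult[OF tendsto_const[of "exp (- z)"] 1] 2] by simp
  show "\<forall>\<^sub>F N in at_top. exp (- z) * (sqrt (2 * ln N) / gumbel_level z N) * exp (- (r N)\<^sup>2 / 2) =
      N * (2 * std_normal_density (gumbel_level z N) / gumbel_level z N)"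
    using eventually_gt_at_top[of 1]
  proof eventually_elim
    case (elim N)
    have L: "0 < ln N" using elim by simp
    have "(gumbel_level z N)\<^sup>2 = 2 * ln N + (2 * z - ln (ln N) - ln pi) + (r N)\<^sup>2"
      using elim by (simp add: gumbel_level_def r_def power2_sum)
    then have "- (gumbel_level z N)\<^sup>2 / 2 = - z + ln (pi * ln N) / 2 - ln N + - (r N)\<^sup>2 / 2"
      using L by (simp add: ln_mult field_simps)
    then have "exp (- (gumbel_level z N)\<^sup>2 / 2) =
        exp (- z) * exp (ln (pi * ln N) / 2) / exp (ln N) * exp (- (r N)\<^sup>2 / 2)"
      by (simp only: exp_add exp_diff)
    also have "exp (ln (pi * ln N) / 2) = sqrt (pi * ln N)"
      using L by (simp add: ln_sqrt[symmetric])
    finally have e: "N * exp (- (gumbel_level z N)\<^sup>2 / 2) = exp (- z) * sqrt (pi * ln N) * exp (- (r N)\<^sup>2 / 2)"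
      using elim by simp
    have s: "2 / sqrt (2 * pi) * sqrt (pi * ln N) = sqrt (2 * ln N)"
      using real_sqrt_mult_self[of 2] by (simp add: real_sqrt_mult field_simps)
    have "N * (2 * std_normal_density (gumbel_level z N) / gumbel_level z N) =
        2 / sqrt (2 * pi) * (N * exp (- (gumbel_level z N)\<^sup>2 / 2)) / gumbel_level z N"
      by (simp add: std_normal_density_def)
    also have "\<dots> = (2 / sqrt (2 * pi) * sqrt (pi * ln N)) * exp (- z) * exp (- (r N)\<^sup>2 / 2) / gumbel_level z N"
      unfolding e by simp
    finally have R: "N * (2 * std_normal_density (gumbel_level z N) / gumbel_level z N) = \<dots>" .
    show ?case unfolding R s by (simp add: mult_ac)
  qed
qed

section \<open>Mills ratio and the independent case\<close>

text \<open>With p the density, -p(x)/x is an antiderivative of p(x)(1 + 1/x^2), whose integral over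
  the half-line is therefore p(u)/u. On that half-line the extra factor lies between 1 and 1 +
  1/u^2, which yields both inequalities.\<close>

lemma std_normal_upper_tail_bounds:
  assumes u: "0 < u"
  defines "Q \<equiv> measure std_normal_distribution {u..}"
  shows "Q \<le> std_normal_density u / u" "std_normal_density u / u \<le> (1 + 1 / u\<^sup>2) * Q"
proof -
  interpret real_distribution std_normal_distribution by (rule real_dist_normal_dist)
  let ?p = std_normal_density
  have Q: "ennreal Q = (\<integral>\<^sup>+x. ennreal (?p x) * indicator {u..} x \<partial>lborel)"
    unfolding Q_def emeasure_eq_measure[symmetric] by (subst emeasure_density) auto
  have F: "(\<integral>\<^sup>+x. ennreal (?p x * (1 + 1 / x\<^sup>2)) * indicator {u..} x \<partial>lborel) = 0 - (- ?p u / u)"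
  proof (rule nn_integral_FTC_atLeast)
    show "((\<lambda>x. - ?p x / x) has_real_derivative ?p x * (1 + 1 / x\<^sup>2)) (at x)" if "u \<le> x" for x
      using that u
      by (auto intro!: derivative_eq_intros std_normal_density_has_derivative
        simp: field_simps power2_eq_square)
    show "((\<lambda>x. - ?p x / x) \<longlongrightarrow> 0) at_top"
      unfolding std_normal_density_def[abs_def] by real_asymp
  qed auto
  have p: "0 \<le> ?p u / u" using u by simp
  have "ennreal Q \<le> ennreal (?p u / u)"
  proof -
    have "?p x \<le> ?p x * (1 + 1 / x\<^sup>2)" for x
      using mult_left_mono[of 1 "1 + 1 / x\<^sup>2" "?p x"] by simp
    then have "ennreal Q \<le> (\<integral>\<^sup>+x. ennreal (?p x * (1 + 1 / x\<^sup>2)) * indicator {u..} x \<partial>lborel)"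
      unfolding Q by (intro nn_integral_mono mult_right_mono ennreal_leI) auto
    then show ?thesis using F by simp
  qed
  then show "Q \<le> ?p u / u" using p by simp
  have "ennreal (?p u / u) \<le> (\<integral>\<^sup>+x. ennreal (1 + 1 / u\<^sup>2) * (ennreal (?p x) * indicator {u..} x) \<partial>lborel)"
  proof -
    have le: "ennreal (?p x * (1 + 1 / x\<^sup>2)) * indicator {u..} x
        \<le> ennreal (1 + 1 / u\<^sup>2) * (ennreal (?p x) * indicator {u..} x)" for x
    proof (cases "u \<le> x")
      case True
      then have "1 / x\<^sup>2 \<le> 1 / u\<^sup>2" using u by (intro divide_left_mono power_mono) auto
      then have "?p x * (1 + 1 / x\<^sup>2) \<le> (1 + 1 / u\<^sup>2) * ?p x"
        by (simp add: mult.commute mult_left_mono)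
      then show ?thesis using True by (simp add: ennreal_mult[symmetric] ennreal_leI del: ennreal_plus)
    qed simp
    have F': "ennreal (?p u / u) = (\<integral>\<^sup>+x. ennreal (?p x * (1 + 1 / x\<^sup>2)) * indicator {u..} x \<partial>lborel)"
      using F by simp
    show ?thesis unfolding F' by (rule nn_integral_mono) (rule le)
  qed
  also have "\<dots> = ennreal (1 + 1 / u\<^sup>2) * ennreal Q"
    unfolding Q by (rule nn_integral_cmult) simp
  also have "\<dots> = ennreal ((1 + 1 / u\<^sup>2) * Q)" by (simp add: ennreal_mult Q_def)
  finally show "?p u / u \<le> (1 + 1 / u\<^sup>2) * Q" by (simp add: Q_def)
qed

lemma std_normal_two_sided_tail:
  assumes u: "0 < u"
  shows "measure std_normal_distribution {x. u \<le> \<bar>x\<bar>} = 2 * measure std_normal_distribution {u..}"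
proof -
  interpret real_distribution std_normal_distribution by (rule real_dist_normal_dist)
  let ?p = std_normal_density
  have "emeasure std_normal_distribution {..-u} = (\<integral>\<^sup>+x. ennreal (?p x) * indicator {..-u} x \<partial>lborel)"
    by (subst emeasure_density) auto
  also have "\<dots> = (\<integral>\<^sup>+x. ennreal (?p (0 + (-1) * x)) * indicator {..-u} (0 + (-1) * x) \<partial>lborel)"
    by (subst nn_integral_real_affine[where c = "-1" and t = 0]) auto
  also have "\<dots> = (\<integral>\<^sup>+x. ennreal (?p x) * indicator {u..} x \<partial>lborel)"
    by (intro nn_integral_cong) (auto simp: std_normal_density_def indicator_def)
  also have "\<dots> = emeasure std_normal_distribution {u..}"
    by (subst emeasure_density) auto
  finally have "measure std_normal_distribution {..-u} = measure std_normal_distribution {u..}"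
    by (simp add: emeasure_eq_measure)
  moreover have "{x. u \<le> \<bar>x\<bar>} = {u..} \<union> {..-u}" by (auto simp: abs_real_def)
  moreover have "measure std_normal_distribution ({u..} \<union> {..-u}) =
      measure std_normal_distribution {u..} + measure std_normal_distribution {..-u}"
    by (rule finite_measure_Union) (use u in auto)
  ultimately show ?thesis by simp
qed

lemma std_normal_gumbel_tail_limit:
  "((\<lambda>N. N * measure std_normal_distribution {x. gumbel_level z N \<le> \<bar>x\<bar>}) \<longlongrightarrow> exp (- z)) at_top"
proof (rule tendsto_sandwich[OF _ _ _ gumbel_level_density_limit])
  let ?R = "\<lambda>N. N * (2 * std_normal_density (gumbel_level z N) / gumbel_level z N)"
  let ?M = "\<lambda>N. measure std_normal_distribution {x. gumbel_level z N \<le> \<bar>x\<bar>}"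
  have pos: "eventually (\<lambda>N. gumbel_level z N > 0) at_top"
    using filterlim_gumbel_level[of z] by (simp add: filterlim_at_top_dense)
  show "eventually (\<lambda>N. N * ?M N \<le> ?R N) at_top"
    using pos eventually_gt_at_top[of 0]
  proof eventually_elim
    case (elim N)
    then show ?case
      using mult_left_mono[OF std_normal_upper_tail_bounds(1)[OF elim(1)], of "2 * N"]
      by (simp add: std_normal_two_sided_tail mult_ac)
  qed
  show "eventually (\<lambda>N. ?R N / (1 + 1 / (gumbel_level z N)\<^sup>2) \<le> N * ?M N) at_top"
    using pos eventually_gt_at_top[of 0]
  proof eventually_elim
    case (elim N)
    have "0 < 1 + 1 / (gumbel_level z N)\<^sup>2" using elim by (simp add: add_pos_nonneg)
    moreover have "?R N \<le> N * ?M N * (1 + 1 / (gumbel_level z N)\<^sup>2)"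
      using elim mult_left_mono[OF std_normal_upper_tail_bounds(2)[OF elim(1)], of "2 * N"]
      by (simp add: std_normal_two_sided_tail mult_ac)
    ultimately show ?case by (simp only: pos_divide_le_eq)
  qed
  have "((\<lambda>N. 1 / (gumbel_level z N)\<^sup>2) \<longlongrightarrow> 0) at_top"
    unfolding gumbel_level_def[abs_def] by real_asymp
  from tendsto_divide[OF gumbel_level_density_limit[of z] tendsto_add[OF tendsto_const[of 1] this]]
  show "((\<lambda>N. ?R N / (1 + 1 / (gumbel_level z N)\<^sup>2)) \<longlongrightarrow> exp (- z)) at_top" by simp
qed

text \<open>After taking logarithms, the error of \<open>ln (1 - q)\<close> against
  \<open>- q\<close> is quadratic. Multiplied by \<open>m\<close> it is at most twice the modulus of
  m q times that of q, a bounded sequence times a null sequence.\<close>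

lemma one_minus_power_tendsto_exp:
  fixes q :: "nat \<Rightarrow> real" and m :: "nat \<Rightarrow> nat"
  assumes q: "q \<longlonglongrightarrow> 0" and mq: "(\<lambda>n. real (m n) * q n) \<longlonglongrightarrow> l"
  shows "(\<lambda>n. (1 - q n) ^ m n) \<longlonglongrightarrow> exp (- l)"
proof -
  have small: "eventually (\<lambda>n. \<bar>q n\<bar> < 1 / 2) sequentially"
    using tendstoD[OF q, of "1 / 2"] by (simp add: dist_real_def)
  have "(\<lambda>n. real (m n) * (ln (1 - q n) + q n)) \<longlonglongrightarrow> 0"
  proof (rule Lim_null_comparison)
    show "eventually (\<lambda>n. norm (real (m n) * (ln (1 - q n) + q n)) \<le> 2 * \<bar>real (m n) * q n\<bar> * \<bar>q n\<bar>) sequentially"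
      using small
    proof eventually_elim
      case (elim n)
      have "\<bar>ln (1 + - q n) - - q n\<bar> \<le> 2 * (- q n)\<^sup>2"
        by (rule abs_ln_one_plus_x_minus_x_bound) (use elim in simp)
      then have "real (m n) * \<bar>ln (1 - q n) + q n\<bar> \<le> real (m n) * (2 * (q n)\<^sup>2)"
        by (intro mult_left_mono) auto
      then show ?case by (simp add: abs_mult power2_eq_square mult_ac)
    qed
    have "(\<lambda>n. 2 * \<bar>real (m n) * q n\<bar> * \<bar>q n\<bar>) \<longlonglongrightarrow> 2 * \<bar>l\<bar> * \<bar>0\<bar>"
      by (intro tendsto_intros q mq)
    then show "(\<lambda>n. 2 * \<bar>real (m n) * q n\<bar> * \<bar>q n\<bar>) \<longlonglongrightarrow> 0" by simp
  qed
  from tendsto_exp[OF tendsto_diff[OF this mq]]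
  have "(\<lambda>n. exp (real (m n) * ln (1 - q n))) \<longlonglongrightarrow> exp (- l)" by (simp add: algebra_simps)
  then show ?thesis
  proof (rule Lim_transform_eventually)
    show "eventually (\<lambda>n. exp (real (m n) * ln (1 - q n)) = (1 - q n) ^ m n) sequentially"
      using small
    proof eventually_elim
      case (elim n)
      then have "1 - q n > 0" by linarith
      then show ?case by (simp add: exp_of_nat_mult)
    qed
  qed
qed

text \<open>Up to powers of \<open>ln N\<close> the terms are N^(1-2a) and N^(3/2-16/9). The first
  exponent is negative exactly because \<open>1 / 2 < a\<close>, the second is -5/18.\<close>

lemma comparison_error_limit:
  fixes a b C :: real
  assumes "1 / 2 < a"
  shows "((\<lambda>N. C * ln N * (8 * b * N * exp (- a * (2 * ln N + (2 * z - ln (ln N) - ln pi)))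
      + (sqrt N * b * N + N\<^sup>2 / sqrt N) / 2 * exp (- (8 / 9) * (2 * ln N + (2 * z - ln (ln N) - ln pi)))))
     \<longlongrightarrow> 0) at_top"
proof -
  have 1: "((\<lambda>N. ln N * (N * exp (- a * (2 * ln N + (2 * z - ln (ln N) - ln pi))))) \<longlongrightarrow> 0) at_top"
    using assms by real_asymp
  have 2: "((\<lambda>N. ln N * ((sqrt N * N) * exp (- (8 / 9) * (2 * ln N + (2 * z - ln (ln N) - ln pi))))) \<longlongrightarrow> 0) at_top"
    by real_asymp
  have 3: "((\<lambda>N. ln N * ((N\<^sup>2 / sqrt N) * exp (- (8 / 9) * (2 * ln N + (2 * z - ln (ln N) - ln pi))))) \<longlongrightarrow> 0) at_top"
    by real_asymp
  have "((\<lambda>N. C * (8 * b * (ln N * (N * exp (- a * (2 * ln N + (2 * z - ln (ln N) - ln pi)))))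
      + b / 2 * (ln N * ((sqrt N * N) * exp (- (8 / 9) * (2 * ln N + (2 * z - ln (ln N) - ln pi)))))
      + 1 / 2 * (ln N * ((N\<^sup>2 / sqrt N) * exp (- (8 / 9) * (2 * ln N + (2 * z - ln (ln N) - ln pi))))))) \<longlongrightarrow>
      C * (8 * b * 0 + b / 2 * 0 + 1 / 2 * 0)) at_top"
    by (intro tendsto_intros 1 2 3)
  then show ?thesis by (simp add: algebra_simps add_divide_distrib)
qed

subsection \<open>Frames\<close>

text \<open>Gaussian elimination with \<open>W\<close> as equations and \<open>I\<close> as
  unknowns. An equation with a pivot removes one equation and one unknown, which preserves the
  strict inequality of cardinalities; an equation without pivot holds for every \<open>u\<close>.
  The index set is generalized in the induction since it shrinks.\<close>

lemma exists_nonzero_orthogonal: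
  fixes \<phi> :: "'w \<Rightarrow> 'i \<Rightarrow> real"
  assumes "finite W" "finite I" "card W < card I"
  shows "\<exists>u. (\<exists>i\<in>I. u i \<noteq> 0) \<and> (\<forall>w\<in>W. inner_on I (\<phi> w) u = 0)"
  using assms
proof (induction W arbitrary: I \<phi> rule: finite_induct)
  case empty
  then have "I \<noteq> {}" by auto
  then show ?case by (intro exI[of _ "\<lambda>_. 1"]) auto
next
  case (insert w W)
  show ?case
  proof (cases "\<forall>i\<in>I. \<phi> w i = 0")
    case True
    have "card W < card I" using insert by simp
    from insert.IH[OF insert.prems(1) this, of \<phi>] obtain u
      where "\<exists>i\<in>I. u i \<noteq> 0" "\<forall>w\<in>W. inner_on I (\<phi> w) u = 0" by blast
    moreover have "inner_on I (\<phi> w) u = 0" using True by (simp add: inner_on_def)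
    ultimately show ?thesis by auto
  next
    case False
    then obtain k where k: "k \<in> I" "\<phi> w k \<noteq> 0" by auto
    define K where "K = I - {k}"
    have K: "finite K" "k \<notin> K" "I = insert k K" "card W < card K"
      using insert k by (auto simp: K_def)
    \<comment> \<open>Row \<open>v\<close> minus the multiple of row \<open>w\<close> that clears
      column \<open>k\<close>; afterwards \<open>u'\<close> restores coordinate \<open>k\<close> by
      back substitution.\<close>
    define \<psi> where "\<psi> = (\<lambda>v i. \<phi> v i - \<phi> v k / \<phi> w k * \<phi> w i)"
    from insert.IH[OF K(1,4), of \<psi>] obtain u
      where u: "\<exists>i\<in>K. u i \<noteq> 0" "\<forall>v\<in>W. inner_on K (\<psi> v) u = 0" by blast
    define s where "s = inner_on K (\<phi> w) u"
    define u' where "u' = u(k := - s / \<phi> w k)"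
    have e: "inner_on I (\<phi> v) u' = - \<phi> v k * s / \<phi> w k + inner_on K (\<phi> v) u" for v
    proof -
      have "(\<Sum>i\<in>K. \<phi> v i * u' i) = (\<Sum>i\<in>K. \<phi> v i * u i)"
        by (rule sum.cong) (use K(2) in \<open>auto simp: u'_def\<close>)
      then show ?thesis using K by (simp add: inner_on_def u'_def)
    qed
    have "inner_on K (\<psi> v) u = inner_on K (\<phi> v) u - \<phi> v k / \<phi> w k * s" for v
      by (simp add: inner_on_def \<psi>_def s_def algebra_simps sum_subtractf sum_distrib_left)
    then have "inner_on I (\<phi> v) u' = 0" if "v \<in> W" for v
      using u(2) that by (simp add: e)
    moreover have "inner_on I (\<phi> w) u' = 0" using k by (simp add: e s_def)
    moreover have "\<exists>i\<in>I. u' i \<noteq> 0"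
    proof -
      from u(1) obtain i where "i \<in> K" "u i \<noteq> 0" by blast
      then show ?thesis using K by (intro bexI[of _ i]) (auto simp: u'_def)
    qed
    ultimately show ?thesis by auto
  qed
qed

lemma L2_set_power2: "(L2_set u I)\<^sup>2 = (\<Sum>i\<in>I. (u i)\<^sup>2)"
  by (simp add: L2_set_def sum_nonneg)

text \<open>A nonzero vector orthogonal to all frame elements would violate the positive lower frame
  bound. On the grids this is what forces the number of frame elements to infinity.\<close>

lemma card_le_card_frame:
  assumes I: "finite I" and fr: "is_frame I W \<phi>"
  shows "card I \<le> card W"
proof (rule ccontr)
  assume "\<not> card I \<le> card W"
  moreover have W: "finite W" using fr by (simp add: is_frame_def)
  ultimately obtain u i where u: "i \<in> I" "u i \<noteq> 0" "\<forall>w\<in>W. inner_on I (\<phi> w) u = 0"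
    using exists_nonzero_orthogonal[OF W I, of \<phi>] by auto
  from fr obtain a b where ab: "frame_constants I W \<phi> a b" by (auto simp: is_frame_def)
  then have "a * (L2_set u I)\<^sup>2 \<le> (\<Sum>\<omega>\<in>W. \<bar>inner_on I (\<phi> \<omega>) u\<bar>\<^sup>2)"
    unfolding frame_constants_def by blast
  also have "\<dots> = 0" using u(3) by simp
  finally have "a * (L2_set u I)\<^sup>2 \<le> 0" .
  moreover have "0 < (L2_set u I)\<^sup>2"
    unfolding L2_set_power2 by (rule sum_pos2[OF I u(1)]) (use u in auto)
  moreover have "0 < a" using ab by (simp add: frame_constants_def)
  ultimately show False by (simp add: mult_le_0_iff)
qed

text \<open>\<open>LEAST\<close> on the reals says something only once the minimum is known to be
  attained. It is attained at \<open>Inf S\<close>: each upper inequality passes to the infimum, and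
  one lower constant \<open>a\<close> goes with it.\<close>

lemma upper_frame_bound:
  assumes I: "finite I" "I \<noteq> {}" and fr: "is_frame I W \<phi>"
  shows "(\<Sum>\<omega>\<in>W. \<bar>inner_on I (\<phi> \<omega>) u\<bar>\<^sup>2) \<le> upper_frame_bound I W \<phi> * (L2_set u I)\<^sup>2"
proof -
  define S where "S = {b. \<exists>a. frame_constants I W \<phi> a b}"
  define F where "F = (\<lambda>u. \<Sum>\<omega>\<in>W. \<bar>inner_on I (\<phi> \<omega>) u\<bar>\<^sup>2)"
  from fr obtain a b where ab: "frame_constants I W \<phi> a b" by (auto simp: is_frame_def)
  then have S: "S \<noteq> {}" by (auto simp: S_def)
  have a: "0 < a" "a * (L2_set u I)\<^sup>2 \<le> F u" for u
    using ab by (auto simp: frame_constants_def F_def)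
  have up: "F u \<le> c * (L2_set u I)\<^sup>2" if "c \<in> S" for c u
    using that by (auto simp: S_def frame_constants_def F_def)
  \<comment> \<open>As \<open>I\<close> is nonempty, the constant vector is nonzero; comparing the
    two frame inequalities on it shows that \<open>a\<close> bounds \<open>S\<close> from
    below.\<close>
  have "0 < (L2_set (\<lambda>_. 1) I)\<^sup>2"
    using I by (simp add: L2_set_power2 card_gt_0_iff)
  then have ac: "a \<le> c" if "c \<in> S" for c
    using order.trans[OF a(2) up[OF that], of "\<lambda>_. 1"] by simp
  have bdd: "bdd_below S" by (rule bdd_belowI[of S a]) (rule ac)
  have F_le: "F u \<le> Inf S * (L2_set u I)\<^sup>2" for u
  proof (cases "(L2_set u I)\<^sup>2 = 0")
    case True
    then show ?thesis using S up[of _ u] by auto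
  next
    case False
    then have pos: "0 < (L2_set u I)\<^sup>2" by simp
    have "F u / (L2_set u I)\<^sup>2 \<le> Inf S"
      using S up pos by (intro cInf_greatest) (auto simp: pos_divide_le_eq)
    then show ?thesis using pos by (simp add: pos_divide_le_eq)
  qed
  have "a \<le> Inf S" using S ac by (intro cInf_greatest) auto
  then have "frame_constants I W \<phi> a (Inf S)"
    using a F_le by (auto simp: frame_constants_def F_def)
  then have "upper_frame_bound I W \<phi> = Inf S"
    unfolding upper_frame_bound_def
    by (intro Least_equality) (auto simp: S_def intro!: cInf_lower[OF _ bdd, unfolded S_def])
  then show ?thesis using F_le by (simp add: F_def)
qed

lemma card_grid: "card (grid d n) = n ^ d"
  by (simp add: grid_def card_PiE)

lemma finite_grid: "finite (grid d n)"
  by (simp add: grid_def finite_PiE)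

section \<open>From squared correlations to the comparison error\<close>

text \<open>The correlations are split at 1/8, a value that makes the exponent
  \<open>1 / (1 + 1 / 8) = 8 / 9\<close>. With u^2 about 2 ln N, the part below the split has
  N^(3/2) against N^(-2/(1+r)) for a split at r, so any r below 1/3 gives decay. \<open>E\<close> is
  a lower bound for u^2 with an explicit form, convenient for the later limit.\<close>

lemma correlation_sum_bound:
  fixes \<kappa> :: "'w \<Rightarrow> 'w \<Rightarrow> real"
  assumes W: "finite W" "real (card W) \<le> N" and N: "1 \<le> N"
    and \<kappa>: "\<And>v w. 0 \<le> \<kappa> v w" "\<And>v w. v \<in> W \<Longrightarrow> w \<in> W \<Longrightarrow> v \<noteq> w \<Longrightarrow> \<kappa> v w \<le> \<rho>"
    and \<kappa>2: "\<And>v. v \<in> W \<Longrightarrow> (\<Sum>w\<in>W. (\<kappa> v w)\<^sup>2) \<le> b" and b: "0 \<le> b"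
    and \<rho>: "0 \<le> \<rho>" and E: "0 \<le> E" "E \<le> u\<^sup>2"
  shows "(\<Sum>v\<in>W. \<Sum>w\<in>W - {v}. \<kappa> v w * exp (- u\<^sup>2 / (1 + \<kappa> v w)))
    \<le> 8 * b * N * exp (- (1 / (1 + \<rho>)) * E)
      + (sqrt N * b * N + N\<^sup>2 / sqrt N) / 2 * exp (- (8 / 9) * E)"
proof -
  define e1 where "e1 = exp (- (1 / (1 + \<rho>)) * E)"
  define e2 where "e2 = exp (- (8 / 9) * E)"
  define s where "s = sqrt N"
  have s: "0 < s" using N by (simp add: s_def)
  have e: "0 \<le> e1" "0 \<le> e2" by (auto simp: e1_def e2_def)
  have pt: "\<kappa> v w * exp (- u\<^sup>2 / (1 + \<kappa> v w)) \<le> 8 * e1 * (\<kappa> v w)\<^sup>2 + e2 / 2 * (s * (\<kappa> v w)\<^sup>2 + 1 / s)"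
    if "v \<in> W" "w \<in> W" "v \<noteq> w" for v w
  proof -
    let ?k = "\<kappa> v w"
    have k: "0 \<le> ?k" "?k \<le> \<rho>" using \<kappa> that by auto
    have bound: "exp (- u\<^sup>2 / (1 + ?k)) \<le> exp (- (1 / (1 + r)) * E)" if "?k \<le> r" for r
    proof -
      have "E / (1 + r) \<le> u\<^sup>2 / (1 + ?k)" using that k E by (intro frac_le) auto
      then show ?thesis by simp
    qed
    show ?thesis
    proof (cases "1 / 8 \<le> ?k")
      case True
      then have "?k \<le> 8 * ?k\<^sup>2" using k by (simp add: power2_eq_square mult_le_cancel_right1)
      then have "?k * exp (- u\<^sup>2 / (1 + ?k)) \<le> (8 * ?k\<^sup>2) * e1"
        unfolding e1_def using k bound[of \<rho>] by (intro mult_mono) auto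
      then have "?k * exp (- u\<^sup>2 / (1 + ?k)) \<le> 8 * e1 * ?k\<^sup>2" by (simp only: mult_ac)
      moreover have "0 \<le> e2 / 2 * (s * ?k\<^sup>2 + 1 / s)" using e s by simp
      ultimately show ?thesis by linarith
    next
      case False
      \<comment> \<open>Weighted AM-GM. The weight \<open>s = sqrt N\<close> balances the row total
        \<open>s * b\<close> of the squares against the \<open>N\<close> constants
        \<open>1 / s\<close>.\<close>
      have "0 \<le> (s * ?k - 1)\<^sup>2 / s" using s by simp
      also have "\<dots> = s * ?k\<^sup>2 + 1 / s - 2 * ?k"
        using s by (simp add: power2_diff field_simps power2_eq_square)
      finally have "?k \<le> (s * ?k\<^sup>2 + 1 / s) / 2" by simp
      moreover have "exp (- u\<^sup>2 / (1 + ?k)) \<le> e2"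
        using bound[of "1 / 8"] False by (simp add: e2_def)
      ultimately have "?k * exp (- u\<^sup>2 / (1 + ?k)) \<le> (s * ?k\<^sup>2 + 1 / s) / 2 * e2"
        using s k by (intro mult_mono) auto
      also have "\<dots> = e2 / 2 * (s * ?k\<^sup>2 + 1 / s)" by simp
      finally have "?k * exp (- u\<^sup>2 / (1 + ?k)) \<le> e2 / 2 * (s * ?k\<^sup>2 + 1 / s)" .
      moreover have "0 \<le> 8 * e1 * ?k\<^sup>2" using e by simp
      ultimately show ?thesis by linarith
    qed
  qed
  have row: "(\<Sum>w\<in>W - {v}. \<kappa> v w * exp (- u\<^sup>2 / (1 + \<kappa> v w))) \<le> 8 * e1 * b + e2 / 2 * (s * b + N / s)"
    if v: "v \<in> W" for v
  proof -
    have "(\<Sum>w\<in>W - {v}. \<kappa> v w * exp (- u\<^sup>2 / (1 + \<kappa> v w)))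
        \<le> (\<Sum>w\<in>W - {v}. 8 * e1 * (\<kappa> v w)\<^sup>2 + e2 / 2 * (s * (\<kappa> v w)\<^sup>2 + 1 / s))"
      using v by (intro sum_mono pt) auto
    also have "\<dots> \<le> (\<Sum>w\<in>W. 8 * e1 * (\<kappa> v w)\<^sup>2 + e2 / 2 * (s * (\<kappa> v w)\<^sup>2 + 1 / s))"
      using W e s by (intro sum_mono2) auto
    also have "\<dots> = 8 * e1 * (\<Sum>w\<in>W. (\<kappa> v w)\<^sup>2) + e2 / 2 * (s * (\<Sum>w\<in>W. (\<kappa> v w)\<^sup>2) + real (card W) * (1 / s))"
      by (simp only: sum.distrib sum_distrib_left[symmetric] sum_constant)
    also have "\<dots> \<le> 8 * e1 * b + e2 / 2 * (s * b + N * (1 / s))"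
      using \<kappa>2[OF v] e s W by (intro add_mono mult_left_mono mult_right_mono) auto
    finally show ?thesis by simp
  qed
  have "(\<Sum>v\<in>W. \<Sum>w\<in>W - {v}. \<kappa> v w * exp (- u\<^sup>2 / (1 + \<kappa> v w)))
      \<le> real (card W) * (8 * e1 * b + e2 / 2 * (s * b + N / s))"
    using row by (rule sum_bounded_above)
  also have "\<dots> \<le> N * (8 * e1 * b + e2 / 2 * (s * b + N / s))"
    using W(2) e b s N by (intro mult_right_mono add_nonneg_nonneg mult_nonneg_nonneg) auto
  also have "\<dots> = 8 * b * N * e1 + (s * b * N + N\<^sup>2 / s) / 2 * e2"
    by (simp add: algebra_simps power2_eq_square)
  finally show ?thesis by (simp only: e1_def e2_def s_def)
qed

subsection \<open>Maxima of frame coefficients\<close>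

lemma distr_gauss_reindex:
  assumes "inj_on f I" "f \<in> I \<rightarrow> K"
  shows "distr (gauss K) (gauss I) (\<lambda>x. \<lambda>i\<in>I. x (f i)) = gauss I"
  using distr_PiM_reindex[OF _ assms, of "\<lambda>_. std_normal_distribution"]
  by (simp add: prob_space_normal_density)

text \<open>Selecting distinct coordinates of a standard Gaussian vector gives a standard Gaussian
  vector. With \<open>Inl\<close> and \<open>Inr\<close> this recovers the two families from their
  joint space.\<close>

lemma integral_gauss_reindex:
  fixes F :: "_ \<Rightarrow> real"
  assumes f: "inj_on f I" "f \<in> I \<rightarrow> K" and F: "F \<in> borel_measurable (gauss I)"
  shows "(LINT y|gauss I. F y) = (LINT x|gauss K. F (\<lambda>i\<in>I. x (f i)))"
proof -
  have "(\<lambda>x. \<lambda>i\<in>I. x (f i)) \<in> measurable (gauss K) (gauss I)"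
    using f by (intro measurable_restrict measurable_component_singleton) auto
  then show ?thesis
    using F by (subst distr_gauss_reindex[OF f, symmetric]) (rule integral_distr)
qed

lemma inner_on_cong: "(\<And>i. i \<in> I \<Longrightarrow> x i = y i) \<Longrightarrow> inner_on I a x = inner_on I a y"
  unfolding inner_on_def by (intro sum.cong) auto

lemma inner_on_Plus:
  assumes "finite I" "finite W"
  shows "inner_on (I <+> W) (case_sum a b) x = inner_on I a (\<lambda>i. x (Inl i)) + inner_on W b (\<lambda>w. x (Inr w))"
  using assms by (simp add: inner_on_def sum.Plus o_def)

lemma inner_on_of_bool:
  assumes "finite W" "v \<in> W"
  shows "inner_on W (\<lambda>w. of_bool (w = v)) y = y v"
proof -
  have "inner_on W (\<lambda>w. of_bool (w = v)) y = (\<Sum>w\<in>W. if w = v then y w else 0)"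
    unfolding inner_on_def by (rule sum.cong) auto
  then show ?thesis using assms by simp
qed

text \<open>The cutoff \<open>g\<close> lies between the indicators of the intervals of half-width
  \<open>u\<close> and \<open>v\<close>. Hence the expected product \<open>eX\<close> lies between
  \<open>p u\<close> and \<open>p v\<close>, while \<open>e\<close>, the expectation of
  \<open>g\<close> under one standard normal, lies between \<open>1 - q u\<close> and
  \<open>1 - q v\<close>. The comparison of \<open>eX\<close> with \<open>e ^ card W\<close> joins
  the two chains.\<close>

lemma max_gauss_comparison:
  fixes \<phi> :: "'w \<Rightarrow> 'i \<Rightarrow> real"
  assumes I: "finite I" and W: "finite W" and unit: "\<And>v. v \<in> W \<Longrightarrow> inner_on I (\<phi> v) (\<phi> v) = 1"
    and uv: "0 \<le> u" "u < v"
  defines "p \<equiv> \<lambda>c. measure (gauss I) {y \<in> space (gauss I). \<forall>\<omega>\<in>W. \<bar>inner_on I (\<phi> \<omega>) y\<bar> \<le> c}"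
    and "q \<equiv> \<lambda>c. measure std_normal_distribution {x. c \<le> \<bar>x\<bar>}"
    and "\<Delta> \<equiv> 8 * (6 / (v - u))\<^sup>2 * (\<Sum>\<omega>\<in>W. \<Sum>\<omega>'\<in>W - {\<omega>}. \<bar>inner_on I (\<phi> \<omega>) (\<phi> \<omega>')\<bar> *
        exp (- u\<^sup>2 / (1 + \<bar>inner_on I (\<phi> \<omega>) (\<phi> \<omega>')\<bar>)))"
  shows "p u \<le> (1 - q v) ^ card W + \<Delta>" "(1 - q u) ^ card W - \<Delta> \<le> p v"
proof -
  interpret S: real_distribution std_normal_distribution by (rule real_dist_normal_dist)
  interpret GI: prob_space "gauss I" by (rule prob_space_gauss)
  obtain g g' g'' :: "real \<Rightarrow> real" and C :: real
  where g: "\<And>x. (g has_real_derivative g' x) (at x)" "\<And>x. (g' has_real_derivative g'' x) (at x)"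
    "\<And>x. isCont g'' x" "\<And>x. 0 \<le> g x" "\<And>x. g x \<le> 1" "\<And>x. \<bar>g' x\<bar> \<le> 6 / (v - u)" "\<And>x. \<bar>g'' x\<bar> \<le> C"
    "\<And>x. \<bar>x\<bar> \<le> u \<Longrightarrow> g x = 1" "\<And>x. v \<le> \<bar>x\<bar> \<Longrightarrow> g x = 0" "\<And>x. \<bar>x\<bar> < u \<Longrightarrow> g' x = 0"
    using smooth_cutoff[OF uv] by metis
  have gm[measurable]: "g \<in> borel_measurable borel"
    using g(1) by (auto intro!: borel_measurable_continuous_onI continuous_at_imp_continuous_on DERIV_isCont)
  have gi: "integrable std_normal_distribution g"
    by (rule integrable_std_normal_distribution_bounded[OF gm, of 1]) (use g(4,5) in auto)
  \<comment> \<open>Disjoint coordinate blocks provide the independence: the \<open>I\<close> block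
    carries the frame coefficients through \<open>A\<close>, the \<open>W\<close> block one fresh
    standard normal per index through \<open>B\<close>.\<close>
  define K where "K = I <+> W"
  have K: "finite K" using I W by (simp add: K_def)
  define A where "A = (\<lambda>v. case_sum (\<phi> v) (\<lambda>_. 0) :: 'i + 'w \<Rightarrow> real)"
  define B where "B = (\<lambda>v. case_sum (\<lambda>_. 0) (\<lambda>w. of_bool (w = v)) :: 'i + 'w \<Rightarrow> real)"
  have Ai: "inner_on K (A v) x = inner_on I (\<phi> v) (\<lambda>i. x (Inl i))" for v x
    unfolding K_def A_def inner_on_Plus[OF I W] by (simp add: inner_on_def)
  have Bi: "inner_on K (B v) x = x (Inr v)" if "v \<in> W" for v x
    using inner_on_of_bool[OF W that] unfolding K_def B_def inner_on_Plus[OF I W]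
    by (simp add: inner_on_def)
  have AA: "inner_on K (A v) (A w) = inner_on I (\<phi> v) (\<phi> w)" for v w
    unfolding Ai by (simp add: A_def)
  have AB: "inner_on K (A v) (B w) = 0" for v w
    unfolding Ai by (simp add: B_def inner_on_def)
  define eX where "eX = (LINT y|gauss I. (\<Prod>\<omega>\<in>W. g (inner_on I (\<phi> \<omega>) y)))"
  have X: "(LINT x|gauss K. (\<Prod>v\<in>W. g (inner_on K (A v) x))) = eX"
  proof -
    have "eX = (LINT x|gauss K. (\<Prod>\<omega>\<in>W. g (inner_on I (\<phi> \<omega>) (\<lambda>i\<in>I. x (Inl i)))))"
      unfolding eX_def by (rule integral_gauss_reindex) (auto simp: K_def)
    moreover have "inner_on I (\<phi> \<omega>) (\<lambda>i\<in>I. x (Inl i)) = inner_on K (A \<omega>) x" for \<omega> x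
      unfolding Ai by (rule inner_on_cong) simp
    ultimately show ?thesis by simp
  qed
  define e where "e = (LINT x|std_normal_distribution. g x)"
  have Y: "(LINT x|gauss K. (\<Prod>v\<in>W. g (inner_on K (B v) x))) = e ^ card W"
  proof -
    interpret P: product_prob_space "\<lambda>_. std_normal_distribution" W by (rule product_prob_space_gauss)
    have "(LINT x|gauss K. (\<Prod>v\<in>W. g (inner_on K (B v) x))) =
        (LINT x|gauss K. (\<Prod>v\<in>W. g ((\<lambda>w\<in>W. x (Inr w)) v)))"
      by (intro Bochner_Integration.integral_cong prod.cong refl) (simp add: Bi)
    also have "\<dots> = (LINT y|gauss W. (\<Prod>v\<in>W. g (y v)))"
      by (rule integral_gauss_reindex[symmetric]) (auto simp: K_def)
    also have "\<dots> = (\<Prod>v\<in>W. e)"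
      unfolding e_def by (rule P.product_integral_prod[OF W gi])
    finally show ?thesis by simp
  qed
  have comp: "\<bar>eX - e ^ card W\<bar> \<le> \<Delta>"
  proof -
    have "\<bar>(LINT x|gauss K. (\<Prod>v\<in>W. g (inner_on K (A v) x))) - (LINT x|gauss K. (\<Prod>v\<in>W. g (inner_on K (B v) x)))\<bar>
      \<le> 8 * (6 / (v - u))\<^sup>2 * (\<Sum>v\<in>W. \<Sum>w\<in>W - {v}. \<bar>inner_on K (A v) (A w)\<bar> *
        exp (- u\<^sup>2 / (1 + \<bar>inner_on K (A v) (A w)\<bar>)))"
      by (rule gauss_comparison[OF K W _ _ _ _ g(1-7,10) uv(1)])
        (use unit in \<open>auto simp: AA AB Bi\<close>, auto simp: B_def)
    then show ?thesis unfolding X Y AA \<Delta>_def .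
  qed
  have prod_le: "(\<Prod>\<omega>\<in>W. g (f \<omega>)) \<le> 1" "0 \<le> (\<Prod>\<omega>\<in>W. g (f \<omega>))" for f :: "'w \<Rightarrow> real"
    using g(4,5) by (auto intro!: prod_le_1 prod_nonneg)
  have eXi: "integrable (gauss I) (\<lambda>y. \<Prod>\<omega>\<in>W. g (inner_on I (\<phi> \<omega>) y))"
    by (rule integrable_gauss_bounded[of _ _ 1]) (use prod_le in auto)
  have E[measurable]: "{y \<in> space (gauss I). \<forall>\<omega>\<in>W. \<bar>inner_on I (\<phi> \<omega>) y\<bar> \<le> c} \<in> sets (gauss I)" for c
    using W by measurable
  have pi: "p c = (LINT y|gauss I. indicator {y \<in> space (gauss I). \<forall>\<omega>\<in>W. \<bar>inner_on I (\<phi> \<omega>) y\<bar> \<le> c} y)" for c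
    unfolding p_def using E by simp
  have ii: "integrable (gauss I) (indicator {y \<in> space (gauss I). \<forall>\<omega>\<in>W. \<bar>inner_on I (\<phi> \<omega>) y\<bar> \<le> c} :: _ \<Rightarrow> real)" for c
    using E by (intro integrable_real_indicator) (auto simp: GI.emeasure_eq_measure)
  have pu: "p u \<le> eX"
    unfolding pi eX_def using ii eXi
    by (rule integral_mono) (auto simp: indicator_def prod_le g(8))
  have pv: "eX \<le> p v"
    unfolding pi eX_def using eXi ii
  proof (rule integral_mono)
    fix y assume y: "y \<in> space (gauss I)"
    show "(\<Prod>\<omega>\<in>W. g (inner_on I (\<phi> \<omega>) y))
      \<le> indicator {y \<in> space (gauss I). \<forall>\<omega>\<in>W. \<bar>inner_on I (\<phi> \<omega>) y\<bar> \<le> v} y"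
    proof (cases "\<forall>\<omega>\<in>W. \<bar>inner_on I (\<phi> \<omega>) y\<bar> \<le> v")
      case False
      then obtain \<omega> where "\<omega> \<in> W" "v < \<bar>inner_on I (\<phi> \<omega>) y\<bar>" by (auto simp: not_le)
      then have "\<exists>\<omega>\<in>W. g (inner_on I (\<phi> \<omega>) y) = 0" using g(9)[OF less_imp_le] by blast
      then have "(\<Prod>\<omega>\<in>W. g (inner_on I (\<phi> \<omega>) y)) = 0" using W by (auto intro: prod_zero)
      then show ?thesis by simp
    qed (use y prod_le in auto)
  qed
  have q_int: "1 - q c = (LINT x|std_normal_distribution. indicator {x. \<bar>x\<bar> < c} x)"
    "integrable std_normal_distribution (indicator {x. \<bar>x\<bar> < c} :: real \<Rightarrow> real)" for c
  proof -
    have e: "{x::real. \<bar>x\<bar> < c} = space std_normal_distribution - {x. c \<le> \<bar>x\<bar>}" by auto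
    have "measure std_normal_distribution {x. \<bar>x\<bar> < c} = 1 - q c"
      unfolding e q_def by (rule S.prob_compl) simp
    then show "1 - q c = (LINT x|std_normal_distribution. indicator {x. \<bar>x\<bar> < c} x)"
      by simp
    show "integrable std_normal_distribution (indicator {x. \<bar>x\<bar> < c} :: real \<Rightarrow> real)"
      by (intro integrable_real_indicator) (auto simp: S.emeasure_eq_measure)
  qed
  have "1 - q u \<le> e"
    unfolding q_int(1) e_def using q_int(2) gi
    by (rule integral_mono) (use g(4,8) in \<open>auto simp: indicator_def\<close>)
  moreover have "e \<le> 1 - q v"
    unfolding q_int(1) e_def using gi q_int(2)
    by (rule integral_mono) (use g(5,9) in \<open>auto simp: indicator_def not_less\<close>)
  moreover have "0 \<le> 1 - q u" unfolding q_def by simp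
  ultimately have "(1 - q u) ^ card W \<le> e ^ card W" "e ^ card W \<le> (1 - q v) ^ card W"
    by (auto intro!: power_mono)
  then show "p u \<le> (1 - q v) ^ card W + \<Delta>" "(1 - q u) ^ card W - \<Delta> \<le> p v"
    using pu pv comp by linarith+
qed

section \<open>Reduction of the noise to the standard product measure\<close>

lemma distr_normal_family:
  fixes \<epsilon> :: "'i \<Rightarrow> 'p \<Rightarrow> real"
  assumes M: "prob_space M" and I: "I \<noteq> {}" and \<sigma>: "0 < \<sigma>"
    and indep: "prob_space.indep_vars M (\<lambda>_. borel) \<epsilon> I"
    and dist: "\<And>i. i \<in> I \<Longrightarrow> distributed M lborel (\<epsilon> i) (normal_density 0 \<sigma>)"
  shows "distr M (\<Pi>\<^sub>M i\<in>I. borel) (\<lambda>x. \<lambda>i\<in>I. \<epsilon> i x / \<sigma>) = gauss I"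
proof -
  interpret prob_space M by (rule M)
  have rv: "random_variable borel (\<lambda>x. \<epsilon> i x / \<sigma>)" if "i \<in> I" for i
    using distributed_measurable[OF dist[OF that]] by simp
  have "indep_vars (\<lambda>_. borel) (\<lambda>i x. \<epsilon> i x / \<sigma>) I"
    by (rule indep_vars_compose2[OF indep]) simp
  then have "distr M (\<Pi>\<^sub>M i\<in>I. borel) (\<lambda>x. \<lambda>i\<in>I. \<epsilon> i x / \<sigma>) = (\<Pi>\<^sub>M i\<in>I. distr M borel (\<lambda>x. \<epsilon> i x / \<sigma>))"
    using indep_vars_iff_distr_eq_PiM'[OF I rv] by simp
  also have "\<dots> = gauss I"
  proof (rule PiM_cong[OF refl])
    fix i assume i: "i \<in> I"
    have "distributed M lborel (\<lambda>x. (\<epsilon> i x - 0) / \<sigma>) std_normal_density"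
      using dist[OF i] normal_standard_normal_convert[OF \<sigma>, of "\<epsilon> i" 0] by blast
    then have "distr M lborel (\<lambda>x. \<epsilon> i x / \<sigma>) = std_normal_distribution"
      by (auto dest: distributed_distr_eq_density)
    then show "distr M borel (\<lambda>x. \<epsilon> i x / \<sigma>) = std_normal_distribution"
      by (simp cong: distr_cong)
  qed
  finally show ?thesis .
qed

lemma measure_normal_family_max:
  fixes \<epsilon> :: "'i \<Rightarrow> 'p \<Rightarrow> real" and \<phi> :: "'w \<Rightarrow> 'i \<Rightarrow> real"
  assumes M: "prob_space M" and I: "finite I" "I \<noteq> {}" and \<sigma>: "0 < \<sigma>"
    and indep: "prob_space.indep_vars M (\<lambda>_. borel) \<epsilon> I"
    and dist: "\<And>i. i \<in> I \<Longrightarrow> distributed M lborel (\<epsilon> i) (normal_density 0 \<sigma>)"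
    and W: "finite W" "W \<noteq> {}"
  shows "measure M {x \<in> space M. Max ((\<lambda>\<omega>. \<bar>inner_on I (\<phi> \<omega>) (\<lambda>i. \<epsilon> i x)\<bar>) ` W) \<le> \<sigma> * c} =
    measure (gauss I) {y \<in> space (gauss I). \<forall>\<omega>\<in>W. \<bar>inner_on I (\<phi> \<omega>) y\<bar> \<le> c}"
proof -
  interpret prob_space M by (rule M)
  let ?T = "\<lambda>x. \<lambda>i\<in>I. \<epsilon> i x / \<sigma>"
  let ?E = "{y \<in> space (gauss I). \<forall>\<omega>\<in>W. \<bar>inner_on I (\<phi> \<omega>) y\<bar> \<le> c}"
  have rv: "random_variable borel (\<lambda>x. \<epsilon> i x / \<sigma>)" if "i \<in> I" for i
    using distributed_measurable[OF dist[OF that]] by simp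
  have T: "?T \<in> measurable M (\<Pi>\<^sub>M i\<in>I. borel)"
    using rv by (rule measurable_restrict)
  have s: "sets (gauss I) = sets (\<Pi>\<^sub>M i\<in>I. (borel :: real measure))"
    by (rule sets_PiM_cong) auto
  have E: "?E \<in> sets (\<Pi>\<^sub>M i\<in>I. (borel :: real measure))"
    unfolding s[symmetric] using W by measurable
  have "measure (gauss I) ?E = measure (distr M (\<Pi>\<^sub>M i\<in>I. borel) ?T) ?E"
    by (subst distr_normal_family[OF M I(2) \<sigma> indep]) (use dist in auto)
  also have "\<dots> = measure M (?T -` ?E \<inter> space M)"
    by (rule measure_distr[OF T E])
  also have "?T -` ?E \<inter> space M = {x \<in> space M. Max ((\<lambda>\<omega>. \<bar>inner_on I (\<phi> \<omega>) (\<lambda>i. \<epsilon> i x)\<bar>) ` W) \<le> \<sigma> * c}"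
  proof -
    have "\<bar>inner_on I a (?T x)\<bar> \<le> c \<longleftrightarrow> \<bar>inner_on I a (\<lambda>i. \<epsilon> i x)\<bar> \<le> \<sigma> * c" for a x
    proof -
      have "inner_on I a (?T x) = inner_on I a (\<lambda>i. \<epsilon> i x) / \<sigma>"
        by (simp add: inner_on_def sum_divide_distrib)
      then show ?thesis using \<sigma> by (simp add: abs_div_pos[symmetric] pos_divide_le_eq mult.commute)
    qed
    moreover have "?T x \<in> space (gauss I)" for x by (simp add: space_PiM)
    ultimately show ?thesis using W by auto
  qed
  finally show ?thesis by simp
qed

text \<open>The constant is \<open>8 * (6 / h)\<^sup>2\<close> for the window \<open>h = \<delta> / sqrt (2 * ln N)\<close>.\<close>

definition comparison_error :: "real \<Rightarrow> real \<Rightarrow> real \<Rightarrow> real \<Rightarrow> real \<Rightarrow> real" where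
  "comparison_error \<delta> b a z N = 576 / \<delta>\<^sup>2 * ln N *
     (8 * b * N * exp (- a * (2 * ln N + (2 * z - ln (ln N) - ln pi)))
      + (sqrt N * b * N + N\<^sup>2 / sqrt N) / 2 * exp (- (8 / 9) * (2 * ln N + (2 * z - ln (ln N) - ln pi))))"

lemma inner_on_self_eq_L2_set: "inner_on I u u = (L2_set u I)\<^sup>2"
  by (simp add: L2_set_power2 sum_power2_eq_inner_on)

text \<open>Because \<open>b\<close> may be any bound on the upper frame bound, it can be chosen
  uniformly over the family; the error then depends on the individual frame only through
  \<open>N\<close>.\<close>

lemma frame_max_comparison:
  fixes \<phi> :: "'w \<Rightarrow> 'i \<Rightarrow> real"
  assumes I: "finite I" "I \<noteq> {}" and fr: "is_frame I \<Omega> \<phi>"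
    and unit: "\<And>\<omega>. \<omega> \<in> \<Omega> \<Longrightarrow> L2_set (\<phi> \<omega>) I = 1"
    and b: "upper_frame_bound I \<Omega> \<phi> \<le> b" "0 \<le> b" and \<rho>: "0 \<le> \<rho>"
    and G: "G \<subseteq> \<Omega>" "\<And>v w. v \<in> G \<Longrightarrow> w \<in> G \<Longrightarrow> v \<noteq> w \<Longrightarrow> \<bar>inner_on I (\<phi> v) (\<phi> w)\<bar> \<le> \<rho>"
    and N: "N = real (card \<Omega>)" "1 < N"
    and u: "0 \<le> gumbel_level z N" and \<delta>: "0 < \<delta>"
    and E: "0 \<le> 2 * ln N + (2 * z - ln (ln N) - ln pi)"
  defines "p \<equiv> \<lambda>c. measure (gauss I) {y \<in> space (gauss I). \<forall>\<omega>\<in>G. \<bar>inner_on I (\<phi> \<omega>) y\<bar> \<le> c}"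
    and "q \<equiv> \<lambda>c. measure std_normal_distribution {x. c \<le> \<bar>x\<bar>}"
    and "\<Delta> \<equiv> comparison_error \<delta> b (1 / (1 + \<rho>)) z N"
  shows "p (gumbel_level z N) \<le> (1 - q (gumbel_level (z + \<delta>) N)) ^ card G + \<Delta>"
    and "(1 - q (gumbel_level z N)) ^ card G - \<Delta> \<le> p (gumbel_level (z + \<delta>) N)"
proof -
  have \<Omega>: "finite \<Omega>" using fr by (simp add: is_frame_def)
  have G_fin: "finite G" using G(1) \<Omega> by (rule finite_subset)
  have L: "0 < ln N" using N by simp
  have diff: "gumbel_level (z + \<delta>) N - gumbel_level z N = \<delta> / sqrt (2 * ln N)"
    using gumbel_level_shift[OF N(2)] by simp
  have lt: "gumbel_level z N < gumbel_level (z + \<delta>) N"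
  proof -
    have "0 < \<delta> / sqrt (2 * ln N)" using \<delta> L by simp
    then show ?thesis using diff by linarith
  qed
  let ?\<kappa> = "\<lambda>v w. \<bar>inner_on I (\<phi> v) (\<phi> w)\<bar>"
  let ?S = "\<Sum>v\<in>G. \<Sum>w\<in>G - {v}. ?\<kappa> v w * exp (- (gumbel_level z N)\<^sup>2 / (1 + ?\<kappa> v w))"
  let ?E = "2 * ln N + (2 * z - ln (ln N) - ln pi)"
  have S: "?S \<le> 8 * b * N * exp (- (1 / (1 + \<rho>)) * ?E) + (sqrt N * b * N + N\<^sup>2 / sqrt N) / 2 * exp (- (8 / 9) * ?E)"
  proof (rule correlation_sum_bound[OF G_fin _ _ _ _ _ b(2) \<rho> E gumbel_level_power2_ge[OF N(2)]])
    show "real (card G) \<le> N" using card_mono[OF \<Omega> G(1)] N by simp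
    \<comment> \<open>The frame inequality is tested on the unit vector \<open>\<phi> v\<close>
      itself.\<close>
    show "(\<Sum>w\<in>G. (?\<kappa> v w)\<^sup>2) \<le> b" if "v \<in> G" for v
    proof -
      have "(\<Sum>w\<in>G. (?\<kappa> v w)\<^sup>2) \<le> (\<Sum>w\<in>\<Omega>. \<bar>inner_on I (\<phi> w) (\<phi> v)\<bar>\<^sup>2)"
        unfolding inner_on_commute[of I "\<phi> v"] using \<Omega> G(1) by (intro sum_mono2) auto
      also have "\<dots> \<le> upper_frame_bound I \<Omega> \<phi> * (L2_set (\<phi> v) I)\<^sup>2"
        by (rule upper_frame_bound[OF I fr])
      also have "\<dots> \<le> b" using that G(1) unit b by (auto simp: subset_iff)
      finally show ?thesis .
    qed
  qed (use N G(2) in auto)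
  have S_le: "8 * (6 / (gumbel_level (z + \<delta>) N - gumbel_level z N))\<^sup>2 * ?S \<le> \<Delta>"
  proof -
    have "8 * (6 / (gumbel_level (z + \<delta>) N - gumbel_level z N))\<^sup>2 = 576 / \<delta>\<^sup>2 * ln N"
      unfolding diff using L \<delta> by (simp add: power_divide power_mult_distrib)
    moreover have "576 / \<delta>\<^sup>2 * ln N * ?S \<le> \<Delta>"
      unfolding \<Delta>_def comparison_error_def using S L \<delta> by (intro mult_left_mono) auto
    ultimately show ?thesis by simp
  qed
  have unit': "inner_on I (\<phi> v) (\<phi> v) = 1" if "v \<in> G" for v
    using that unit G(1) by (auto simp: inner_on_self_eq_L2_set subset_iff)
  have "p (gumbel_level z N) \<le> (1 - q (gumbel_level (z + \<delta>) N)) ^ card G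
      + 8 * (6 / (gumbel_level (z + \<delta>) N - gumbel_level z N))\<^sup>2 * ?S"
    unfolding p_def q_def by (rule max_gauss_comparison(1)[OF I(1) G_fin unit' u lt])
  then show "p (gumbel_level z N) \<le> (1 - q (gumbel_level (z + \<delta>) N)) ^ card G + \<Delta>"
    using S_le by linarith
  have "(1 - q (gumbel_level z N)) ^ card G
      - 8 * (6 / (gumbel_level (z + \<delta>) N - gumbel_level z N))\<^sup>2 * ?S \<le> p (gumbel_level (z + \<delta>) N)"
    unfolding p_def q_def by (rule max_gauss_comparison(2)[OF I(1) G_fin unit' u lt])
  then show "(1 - q (gumbel_level z N)) ^ card G - \<Delta> \<le> p (gumbel_level (z + \<delta>) N)"
    using S_le by linarith
qed

section \<open>Removal of correlated indices and passage to the limit\<close>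

text \<open>Fewer constraints give a larger event, and the excess is contained in the union of the
  exceedances of the removed indices, to which the union bound applies.\<close>

lemma max_restrict_bounds:
  fixes \<phi> :: "'w \<Rightarrow> 'i \<Rightarrow> real"
  assumes I: "finite I" and \<Omega>: "finite \<Omega>" and G: "G \<subseteq> \<Omega>" and u: "0 \<le> u"
    and unit: "\<And>\<omega>. \<omega> \<in> \<Omega> \<Longrightarrow> inner_on I (\<phi> \<omega>) (\<phi> \<omega>) = 1"
  defines "p \<equiv> \<lambda>W. measure (gauss I) {y \<in> space (gauss I). \<forall>\<omega>\<in>W. \<bar>inner_on I (\<phi> \<omega>) y\<bar> \<le> u}"
  shows "p \<Omega> \<le> p G" "p G \<le> p \<Omega> + real (card (\<Omega> - G)) * (2 * exp (- u\<^sup>2 / 2))"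
proof -
  interpret prob_space "gauss I" by (rule prob_space_gauss)
  let ?E = "\<lambda>W. {y \<in> space (gauss I). \<forall>\<omega>\<in>W. \<bar>inner_on I (\<phi> \<omega>) y\<bar> \<le> u}"
  let ?F = "\<lambda>\<omega>. {y \<in> space (gauss I). u \<le> \<bar>inner_on I (\<phi> \<omega>) y\<bar>}"
  have E: "?E W \<in> sets (gauss I)" if "W \<subseteq> \<Omega>" for W
    using finite_subset[OF that \<Omega>] by measurable
  have F: "?F \<omega> \<in> sets (gauss I)" for \<omega> by measurable
  have U: "(\<Union>\<omega>\<in>\<Omega> - G. ?F \<omega>) \<in> sets (gauss I)"
    using \<Omega> F by (intro sets.finite_UN) auto
  show "p \<Omega> \<le> p G"
    unfolding p_def using E[OF G] G by (intro finite_measure_mono) auto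
  have "p G \<le> measure (gauss I) (?E \<Omega> \<union> (\<Union>\<omega>\<in>\<Omega> - G. ?F \<omega>))"
    unfolding p_def
  proof (rule finite_measure_mono)
    show "?E \<Omega> \<union> (\<Union>\<omega>\<in>\<Omega> - G. ?F \<omega>) \<in> sets (gauss I)"
      using E[OF order.refl] U by (rule sets.Un)
    show "?E G \<subseteq> ?E \<Omega> \<union> (\<Union>\<omega>\<in>\<Omega> - G. ?F \<omega>)"
    proof
      fix y assume y: "y \<in> ?E G"
      show "y \<in> ?E \<Omega> \<union> (\<Union>\<omega>\<in>\<Omega> - G. ?F \<omega>)"
      proof (cases "y \<in> ?E \<Omega>")
        case False
        then obtain \<omega> where "\<omega> \<in> \<Omega>" "u < \<bar>inner_on I (\<phi> \<omega>) y\<bar>" using y by (auto simp: not_le)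
        then show ?thesis using y by (intro UnI2 UN_I[of \<omega>]) force+
      qed simp
    qed
  qed
  also have "\<dots> \<le> measure (gauss I) (?E \<Omega>) + measure (gauss I) (\<Union>\<omega>\<in>\<Omega> - G. ?F \<omega>)"
    by (rule measure_Un_le[OF E[OF order.refl] U])
  also have "measure (gauss I) (\<Union>\<omega>\<in>\<Omega> - G. ?F \<omega>) \<le> (\<Sum>\<omega>\<in>\<Omega> - G. measure (gauss I) (?F \<omega>))"
    using \<Omega> F by (intro measure_UNION_le) auto
  also have "\<dots> \<le> real (card (\<Omega> - G)) * (2 * exp (- u\<^sup>2 / 2))"
    by (rule sum_bounded_above) (use gauss_abs_tail[OF I unit u] in auto)
  finally show "p G \<le> p \<Omega> + real (card (\<Omega> - G)) * (2 * exp (- u\<^sup>2 / 2))"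
    by (simp add: p_def)
qed

text \<open>\<delta> stays fixed while \<open>n\<close> tends to infinity, so every error may depend
  on it arbitrarily; continuity of the limit function then lets \<delta> tend to 0.\<close>

lemma squeeze_shifted:
  fixes P :: "nat \<Rightarrow> real" and f :: "real \<Rightarrow> real"
  assumes f: "isCont f z"
    and lo: "\<And>\<delta>. 0 < \<delta> \<Longrightarrow> \<exists>l. l \<longlonglongrightarrow> f (z - \<delta>) \<and> (\<forall>\<^sub>F n in sequentially. l n \<le> P n)"
    and hi: "\<And>\<delta>. 0 < \<delta> \<Longrightarrow> \<exists>h. h \<longlonglongrightarrow> f (z + \<delta>) \<and> (\<forall>\<^sub>F n in sequentially. P n \<le> h n)"
  shows "P \<longlonglongrightarrow> f z"
proof (rule order_tendstoI)
  fix a assume a: "a < f z"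
  have "((\<lambda>\<delta>. f (z - \<delta>)) \<longlongrightarrow> f z) (at_right 0)"
    by (rule isCont_tendsto_compose[OF f]) (auto intro!: tendsto_eq_intros)
  then have "\<forall>\<^sub>F \<delta> in at_right 0. a < f (z - \<delta>)" using a by (rule order_tendstoD)
  from eventually_happens[OF eventually_conj[OF this eventually_at_right_less]]
  obtain \<delta> where \<delta>: "a < f (z - \<delta>)" "0 < \<delta>" by auto
  from lo[OF \<delta>(2)] obtain l where l: "l \<longlonglongrightarrow> f (z - \<delta>)" "\<forall>\<^sub>F n in sequentially. l n \<le> P n" by blast
  show "\<forall>\<^sub>F n in sequentially. a < P n"
    using order_tendstoD(1)[OF l(1) \<delta>(1)] l(2) by eventually_elim simp
next
  fix a assume a: "f z < a"
  have "((\<lambda>\<delta>. f (z + \<delta>)) \<longlongrightarrow> f z) (at_right 0)"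
    by (rule isCont_tendsto_compose[OF f]) (auto intro!: tendsto_eq_intros)
  then have "\<forall>\<^sub>F \<delta> in at_right 0. f (z + \<delta>) < a" using a by (rule order_tendstoD)
  from eventually_happens[OF eventually_conj[OF this eventually_at_right_less]]
  obtain \<delta> where \<delta>: "f (z + \<delta>) < a" "0 < \<delta>" by auto
  from hi[OF \<delta>(2)] obtain h where h: "h \<longlonglongrightarrow> f (z + \<delta>)" "\<forall>\<^sub>F n in sequentially. P n \<le> h n" by blast
  show "\<forall>\<^sub>F n in sequentially. P n < a"
    using order_tendstoD(2)[OF h(1) \<delta>(1)] h(2) by eventually_elim simp
qed

lemma asymptotically_stable_max_limit:
  fixes I :: "nat \<Rightarrow> 'i set" and \<Omega> :: "nat \<Rightarrow> 'w set"
  assumes st: "asymptotically_stable I \<Omega> \<phi>"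
    and I: "\<And>n. 1 \<le> n \<Longrightarrow> finite (I n)" "\<And>n. 1 \<le> n \<Longrightarrow> I n \<noteq> {}"
    and N_lim: "filterlim (\<lambda>n. real (card (\<Omega> n))) at_top sequentially"
  shows "(\<lambda>n. measure (gauss (I n)) {y \<in> space (gauss (I n)).
      \<forall>\<omega>\<in>\<Omega> n. \<bar>inner_on (I n) (\<phi> n \<omega>) y\<bar> \<le> gumbel_level z (real (card (\<Omega> n)))})
    \<longlonglongrightarrow> exp (- exp (- z))" (is "?P \<longlonglongrightarrow> _")
proof -
  define N where "N = (\<lambda>n. real (card (\<Omega> n)))"
  have N_lim: "filterlim N at_top sequentially" using N_lim by (simp add: N_def)
  define q where "q = (\<lambda>c. measure std_normal_distribution {x. c \<le> \<bar>x\<bar>})"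
  have fr: "is_frame (I n) (\<Omega> n) (\<phi> n)" if "1 \<le> n" for n
    using st that by (simp add: asymptotically_stable_def)
  have unit: "L2_set (\<phi> n \<omega>) (I n) = 1" if "1 \<le> n" "\<omega> \<in> \<Omega> n" for n \<omega>
    using st that by (simp add: asymptotically_stable_def)
  have \<Omega>: "finite (\<Omega> n)" if "1 \<le> n" for n using fr[OF that] by (simp add: is_frame_def)
  have "bdd_above ((\<lambda>n. upper_frame_bound (I n) (\<Omega> n) (\<phi> n)) ` {1..})"
    using st by (simp add: asymptotically_stable_def)
  then obtain b' where b': "upper_frame_bound (I n) (\<Omega> n) (\<phi> n) \<le> b'" if "1 \<le> n" for n
    by (auto simp: bdd_above_def)
  define b where "b = max 0 b'"
  have b: "upper_frame_bound (I n) (\<Omega> n) (\<phi> n) \<le> b" "0 \<le> b" if "1 \<le> n" for n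
    using b'[OF that] by (auto simp: b_def)
  define pairs where "pairs = (\<lambda>\<rho> n. {(\<omega>, \<omega>'). \<omega> \<in> \<Omega> n \<and> \<omega>' \<in> \<Omega> n \<and> \<omega> \<noteq> \<omega>' \<and>
    \<bar>inner_on (I n) (\<phi> n \<omega>) (\<phi> n \<omega>')\<bar> \<ge> \<rho>})"
  obtain \<rho> where \<rho>: "0 < \<rho>" "\<rho> < 1"
    and pairs: "(\<lambda>n. real (card (pairs \<rho> n))) \<in> o(\<lambda>n. N n / sqrt (ln (N n)))"
    using st unfolding asymptotically_stable_def pairs_def N_def by blast
  \<comment> \<open>Removing first components suffices: a strongly correlated pair inside
    \<open>G n\<close> would have its own first component removed.\<close>
  define G where "G = (\<lambda>n. \<Omega> n - fst ` pairs \<rho> n)"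
  have G_sub: "G n \<subseteq> \<Omega> n" for n by (auto simp: G_def)
  have G: "\<bar>inner_on (I n) (\<phi> n v) (\<phi> n w)\<bar> \<le> \<rho>" if "v \<in> G n" "w \<in> G n" "v \<noteq> w" for n v w
    using that by (force simp: G_def pairs_def image_iff)
  have card_bad: "card (\<Omega> n - G n) \<le> card (pairs \<rho> n)" if "1 \<le> n" for n
  proof -
    have "finite (pairs \<rho> n)"
      by (rule finite_subset[of _ "\<Omega> n \<times> \<Omega> n"]) (use \<Omega>[OF that] in \<open>auto simp: pairs_def\<close>)
    moreover have "\<Omega> n - G n \<subseteq> fst ` pairs \<rho> n" by (auto simp: G_def)
    ultimately show ?thesis by (meson card_image_le card_mono finite_imageI order.trans)
  qed
  have ev1: "\<forall>\<^sub>F n in sequentially. 1 \<le> n" by (rule eventually_ge_at_top)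
  \<comment> \<open>Beyond \<open>exp 1\<close> the factor \<open>sqrt (ln N)\<close> is at least 1,
    so \<open>bad\<close> also dominates the fraction of removed indices.\<close>
  have N1: "\<forall>\<^sub>F n in sequentially. exp 1 < N n"
    using N_lim by (simp add: filterlim_at_top_dense)
  \<comment> \<open>Up to a constant depending on \<open>z\<close>, this is the total exceedance
    probability of the removed indices; it is the quantity that stability condition (i) makes
    vanish.\<close>
  define bad where "bad = (\<lambda>n. real (card (\<Omega> n - G n)) * sqrt (ln (N n)) / N n)"
  have bad: "bad \<longlonglongrightarrow> 0"
  proof (rule Lim_null_comparison)
    show "(\<lambda>n. real (card (pairs \<rho> n)) / (N n / sqrt (ln (N n)))) \<longlonglongrightarrow> 0"
      using smalloD_tendsto[OF pairs] by simp
    show "\<forall>\<^sub>F n in sequentially. norm (bad n) \<le> real (card (pairs \<rho> n)) / (N n / sqrt (ln (N n)))"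
      using ev1 N1
    proof eventually_elim
      case (elim n)
      have N: "1 < N n" using elim(2) less_trans[of 1 "exp 1" "N n"] by simp
      then show ?case
        using card_bad[OF elim(1)] by (auto simp: bad_def intro!: divide_right_mono mult_right_mono)
    qed
  qed
  have card_G: "(\<lambda>n. real (card (G n)) / N n) \<longlonglongrightarrow> 1"
  proof -
    have "(\<lambda>n. 1 - real (card (G n)) / N n) \<longlonglongrightarrow> 0"
    proof (rule Lim_null_comparison[OF _ bad])
      show "\<forall>\<^sub>F n in sequentially. norm (1 - real (card (G n)) / N n) \<le> bad n"
        using ev1 N1
      proof eventually_elim
        case (elim n)
        have N: "1 < N n" using elim(2) less_trans[of 1 "exp 1" "N n"] by simp
        have L: "1 \<le> sqrt (ln (N n))" using elim(2) N ln_ge_iff[of "N n" 1] by simp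
        have c: "real (card (\<Omega> n - G n)) = N n - real (card (G n))"
          using card_Diff_subset[OF finite_subset[OF G_sub \<Omega>[OF elim(1)]] G_sub]
            card_mono[OF \<Omega>[OF elim(1)] G_sub] by (simp add: N_def of_nat_diff)
        have "1 - real (card (G n)) / N n = real (card (\<Omega> n - G n)) / N n"
          unfolding c using N by (simp add: field_simps)
        also have "\<dots> \<le> bad n"
          unfolding bad_def using L N by (intro divide_right_mono) (auto simp: mult_le_cancel_left1)
        finally have "1 - real (card (G n)) / N n \<le> bad n" .
        moreover have "0 \<le> 1 - real (card (G n)) / N n"
          using N card_mono[OF \<Omega>[OF elim(1)] G_sub] by (simp add: N_def field_simps)
        ultimately show ?case by simp
      qed
    qed
    from tendsto_diff[OF tendsto_const[of 1] this] show ?thesis by simp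
  qed
  \<comment> \<open>The level is computed from \<open>N n\<close> but only \<open>card (G n)\<close>
    factors remain. Their ratio tends to 1, so the expected number of exceedances keeps its limit
    \<open>exp (- z)\<close>.\<close>
  have pow: "(\<lambda>n. (1 - q (gumbel_level z (N n))) ^ card (G n)) \<longlonglongrightarrow> exp (- exp (- z))" for z
  proof (rule one_minus_power_tendsto_exp)
    have Nq: "(\<lambda>n. N n * q (gumbel_level z (N n))) \<longlonglongrightarrow> exp (- z)"
      unfolding q_def by (rule filterlim_compose[OF std_normal_gumbel_tail_limit N_lim])
    have N0: "\<forall>\<^sub>F n in sequentially. N n \<noteq> 0" using N1 by eventually_elim auto
    have "(\<lambda>n. N n * q (gumbel_level z (N n)) * inverse (N n)) \<longlonglongrightarrow> 0"
      using tendsto_mult[OF Nq tendsto_inverse_0_at_top[OF N_lim]] by simp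
    then show "(\<lambda>n. q (gumbel_level z (N n))) \<longlonglongrightarrow> 0"
      by (rule Lim_transform_eventually) (rule eventually_mono[OF N0], simp)
    have "(\<lambda>n. real (card (G n)) / N n * (N n * q (gumbel_level z (N n)))) \<longlonglongrightarrow> exp (- z)"
      using tendsto_mult[OF card_G Nq] by simp
    then show "(\<lambda>n. real (card (G n)) * q (gumbel_level z (N n))) \<longlonglongrightarrow> exp (- z)"
      by (rule Lim_transform_eventually) (rule eventually_mono[OF N0], simp)
  qed
  define a where "a = 1 / (1 + \<rho>)"
  \<comment> \<open>This is where \<open>\<rho> < 1\<close> enters: it is equivalent to the exponent
    condition of \<open>comparison_error_limit\<close>.\<close>
  have a: "1 / 2 < a" using \<rho> by (simp add: a_def field_simps)
  have err: "(\<lambda>n. comparison_error \<delta> b a z (N n)) \<longlonglongrightarrow> 0" for \<delta> z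
    unfolding comparison_error_def by (rule filterlim_compose[OF comparison_error_limit[OF a] N_lim])
  have level: "\<forall>\<^sub>F n in sequentially. 0 \<le> gumbel_level z (N n)" for z
    using filterlim_compose[OF filterlim_gumbel_level[of z] N_lim] by (simp add: filterlim_at_top)
  have E_lim: "\<forall>\<^sub>F n in sequentially. 0 \<le> 2 * ln (N n) + (2 * z - ln (ln (N n)) - ln pi)" for z
  proof -
    have "filterlim (\<lambda>N. 2 * ln N + (2 * z - ln (ln N) - ln pi)) at_top at_top" by real_asymp
    from filterlim_compose[OF this N_lim] show ?thesis by (simp add: filterlim_at_top)
  qed
  define pG where "pG = (\<lambda>n c. measure (gauss (I n)) {y \<in> space (gauss (I n)).
      \<forall>\<omega>\<in>G n. \<bar>inner_on (I n) (\<phi> n \<omega>) y\<bar> \<le> c})"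
  have cmp: "\<forall>\<^sub>F n in sequentially.
      pG n (gumbel_level z (N n)) \<le> (1 - q (gumbel_level (z + \<delta>) (N n))) ^ card (G n) + comparison_error \<delta> b a z (N n) \<and>
      (1 - q (gumbel_level z (N n))) ^ card (G n) - comparison_error \<delta> b a z (N n) \<le> pG n (gumbel_level (z + \<delta>) (N n))"
    if "0 < \<delta>" for \<delta> z
    using ev1 N1 level[of z] E_lim[of z]
  proof eventually_elim
    case (elim n)
    have N: "1 < N n" using elim(2) less_trans[of 1 "exp 1" "N n"] by simp
    show ?case
      unfolding pG_def q_def a_def
      using frame_max_comparison[OF I[OF elim(1)] fr[OF elim(1)] unit[OF elim(1)] b[OF elim(1)] less_imp_le[OF \<rho>(1)]
        G_sub G N_def[THEN fun_cong] N elim(3) that elim(4)] by blast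
  qed
  have res: "\<forall>\<^sub>F n in sequentially. ?P n \<le> pG n (gumbel_level z (N n)) \<and>
      pG n (gumbel_level z (N n)) \<le> ?P n + 2 * exp (- z) * sqrt pi * bad n"
    using ev1 N1 level[of z]
  proof eventually_elim
    case (elim n)
    have N: "1 < N n" using elim(2) less_trans[of 1 "exp 1" "N n"] by simp
    have un: "inner_on (I n) (\<phi> n \<omega>) (\<phi> n \<omega>) = 1" if "\<omega> \<in> \<Omega> n" for \<omega>
      using unit[OF elim(1) that] by (simp add: inner_on_self_eq_L2_set)
    have "?P n \<le> pG n (gumbel_level z (N n))"
      unfolding pG_def N_def
      by (rule max_restrict_bounds(1)[OF I(1)[OF elim(1)] \<Omega>[OF elim(1)] G_sub elim(3)[unfolded N_def] un])
    moreover have "pG n (gumbel_level z (N n)) \<le>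
        ?P n + real (card (\<Omega> n - G n)) * (2 * exp (- (gumbel_level z (N n))\<^sup>2 / 2))"
      unfolding pG_def N_def
      by (rule max_restrict_bounds(2)[OF I(1)[OF elim(1)] \<Omega>[OF elim(1)] G_sub elim(3)[unfolded N_def] un])
    moreover have "real (card (\<Omega> n - G n)) * (2 * exp (- (gumbel_level z (N n))\<^sup>2 / 2))
        \<le> 2 * exp (- z) * sqrt pi * bad n"
    proof -
      have "real (card (\<Omega> n - G n)) * (2 * exp (- (gumbel_level z (N n))\<^sup>2 / 2))
          \<le> real (card (\<Omega> n - G n)) * (2 * (exp (- z) * sqrt (pi * ln (N n)) / N n))"
        using exp_gumbel_level_le[OF N, of z] by (intro mult_left_mono) auto
      also have "\<dots> = 2 * exp (- z) * sqrt pi * bad n"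
        by (simp add: bad_def real_sqrt_mult)
      finally show ?thesis .
    qed
    ultimately show ?case by linarith
  qed
  show ?thesis
  proof (rule squeeze_shifted[where f = "\<lambda>z. exp (- exp (- z))"])
    fix \<delta> :: real assume \<delta>: "0 < \<delta>"
    let ?h = "\<lambda>n. (1 - q (gumbel_level (z + \<delta>) (N n))) ^ card (G n) + comparison_error \<delta> b a z (N n)"
    have "?h \<longlonglongrightarrow> exp (- exp (- (z + \<delta>)))"
      using tendsto_add[OF pow[of "z + \<delta>"] err[of \<delta> z]] by (simp only: add_0_right)
    moreover have "\<forall>\<^sub>F n in sequentially. ?P n \<le> ?h n"
      using res cmp[OF \<delta>, of z] by eventually_elim linarith
    ultimately show "\<exists>h. h \<longlonglongrightarrow> exp (- exp (- (z + \<delta>))) \<and> (\<forall>\<^sub>F n in sequentially. ?P n \<le> h n)"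
      by blast
    \<comment> \<open>The lower bound compares the levels at \<open>z - \<delta>\<close> and
      \<open>z\<close>, so the comparison error is taken at \<open>z - \<delta>\<close>, whereas the
      removal cost belongs to the actual level at \<open>z\<close>.\<close>
    let ?l = "\<lambda>n. (1 - q (gumbel_level (z - \<delta>) (N n))) ^ card (G n) - comparison_error \<delta> b a (z - \<delta>) (N n)
      - 2 * exp (- z) * sqrt pi * bad n"
    have "?l \<longlonglongrightarrow> exp (- exp (- (z - \<delta>))) - 0 - 2 * exp (- z) * sqrt pi * 0"
      by (intro tendsto_diff tendsto_mult tendsto_const pow err bad)
    then have "?l \<longlonglongrightarrow> exp (- exp (- (z - \<delta>)))" by simp
    moreover have "\<forall>\<^sub>F n in sequentially. ?l n \<le> ?P n"
      using res cmp[OF \<delta>, of "z - \<delta>"]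
    proof eventually_elim
      case (elim n)
      then show ?case by simp
    qed
    ultimately show "\<exists>l. l \<longlonglongrightarrow> exp (- exp (- (z - \<delta>))) \<and> (\<forall>\<^sub>F n in sequentially. l n \<le> ?P n)"
      by blast
  qed (intro continuous_intros)
qed

theorem theorem1p3:
  fixes d :: nat and \<sigma> z :: real
    and \<Omega> :: "nat \<Rightarrow> 'w set"
    and \<phi> :: "nat \<Rightarrow> 'w \<Rightarrow> (nat \<Rightarrow> nat) \<Rightarrow> real"
    and M :: "'p measure"
    and \<epsilon> :: "nat \<Rightarrow> (nat \<Rightarrow> nat) \<Rightarrow> 'p \<Rightarrow> real"
  assumes "d \<ge> 1" and "\<sigma> > 0"
    and "asymptotically_stable (grid d) \<Omega> \<phi>"
    and "prob_space M"
    and "\<And>n. n \<ge> 1 \<Longrightarrow> prob_space.indep_vars M (\<lambda>_. borel) (\<epsilon> n) (grid d n)"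
    and "\<And>n i. n \<ge> 1 \<Longrightarrow> i \<in> grid d n \<Longrightarrow>
           distributed M lborel (\<epsilon> n i) (normal_density 0 \<sigma>)"
  shows "(\<lambda>n. measure M {x \<in> space M.
            Max ((\<lambda>\<omega>. \<bar>inner_on (grid d n) (\<phi> n \<omega>) (\<lambda>i. \<epsilon> n i x)\<bar>) ` \<Omega> n)
              \<le> \<sigma> * sqrt (2 * ln (real (card (\<Omega> n))))
                + \<sigma> * ((2 * z - ln (ln (real (card (\<Omega> n)))) - ln pi)
                        / (2 * sqrt (2 * ln (real (card (\<Omega> n))))))})
         \<longlonglongrightarrow> exp (- exp (- z))"
proof -
  have grid_ne: "grid d n \<noteq> {}" if "1 \<le> n" for n
  proof -
    have "0 < card (grid d n)" using that by (simp add: card_grid)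
    then show ?thesis by auto
  qed
  have fr: "is_frame (grid d n) (\<Omega> n) (\<phi> n)" if "1 \<le> n" for n
    using assms(3) that by (simp add: asymptotically_stable_def)
  have card_ge: "n \<le> card (\<Omega> n)" if "1 \<le> n" for n
  proof -
    \<comment> \<open>The dimension being at least 1 makes the grid, and with it the frame, grow
      without bound.\<close>
    have "n \<le> n ^ d" using assms(1) that by (simp add: self_le_power)
    also have "\<dots> \<le> card (\<Omega> n)"
      using card_le_card_frame[OF finite_grid fr[OF that]] by (simp add: card_grid)
    finally show ?thesis .
  qed
  have "filterlim (\<lambda>n. real (card (\<Omega> n))) at_top sequentially"
  proof (rule filterlim_at_top_mono[OF filterlim_real_sequentially])
    show "\<forall>\<^sub>F n in sequentially. real n \<le> real (card (\<Omega> n))"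
      using eventually_ge_at_top[of 1] by eventually_elim (use card_ge in simp)
  qed
  from asymptotically_stable_max_limit[OF assms(3) finite_grid grid_ne this]
  have "(\<lambda>n. measure (gauss (grid d n)) {y \<in> space (gauss (grid d n)).
      \<forall>\<omega>\<in>\<Omega> n. \<bar>inner_on (grid d n) (\<phi> n \<omega>) y\<bar> \<le> gumbel_level z (real (card (\<Omega> n)))})
    \<longlonglongrightarrow> exp (- exp (- z))" .
  then show ?thesis
  proof (rule Lim_transform_eventually)
    show "\<forall>\<^sub>F n in sequentially. measure (gauss (grid d n)) {y \<in> space (gauss (grid d n)).
        \<forall>\<omega>\<in>\<Omega> n. \<bar>inner_on (grid d n) (\<phi> n \<omega>) y\<bar> \<le> gumbel_level z (real (card (\<Omega> n)))} =
      measure M {x \<in> space M.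
            Max ((\<lambda>\<omega>. \<bar>inner_on (grid d n) (\<phi> n \<omega>) (\<lambda>i. \<epsilon> n i x)\<bar>) ` \<Omega> n)
              \<le> \<sigma> * sqrt (2 * ln (real (card (\<Omega> n))))
                + \<sigma> * ((2 * z - ln (ln (real (card (\<Omega> n)))) - ln pi)
                        / (2 * sqrt (2 * ln (real (card (\<Omega> n))))))}"
      using eventually_ge_at_top[of 1]
    proof eventually_elim
      case (elim n)
      \<comment> \<open>\<open>Max\<close> has its intended meaning only on a finite nonempty set,
        which the cardinality bound guarantees for \<open>n \<ge> 1\<close>.\<close>
      have \<Omega>: "finite (\<Omega> n)" "\<Omega> n \<noteq> {}"
        using fr[OF elim] card_ge[OF elim] elim by (auto simp: is_frame_def)
      show ?case
        unfolding gumbel_level_def distrib_left[symmetric]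
        by (rule measure_normal_family_max[symmetric, OF assms(4) finite_grid grid_ne[OF elim] assms(2)
          assms(5)[OF elim] assms(6)[OF elim] \<Omega>])
    qed
  qed
qed

end
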